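(* Let $P_*=X_{1*}X_{1*}^H\in\mathbb{C}^{n\times n}$ be a fixed point of the SCF map $\Psi$, i.e. $P_*=\Psi(P_* )$, where $X_*=[X_{1*},X_{2*}]\in\mathbb{C}^{n\times n}$ is unitary, $X_{1*}\in\mathbb{C}^{n\times p}$, and $A(P_* )X_*=X_*\,\mathrm{diag}(\lambda_1,\ldots,\lambda_n)$ with $\lambda_1\le\cdots\le\lambda_n$ and $\lambda_{p+1}-\lambda_p\neq 0$. Then the SCF iteration $P_{k+1}=\Psi(P_k)$ satisfies $$\operatorname{vech}(P_{k+1}-P_* )=\operatorname{vech}(\Psi(P_k)-P_* )=J_P\operatorname{vech}(P_k-P_* )+O\big(\|\operatorname{vech}(P_k-P_* )\|^2\big)$$ (as $P_k\to P_*$), where $$J_P=-T(\overline{X_*}\otimes X_* )\,D\,(X_*^T\otimes X_*^H)\,L'$$ and $L'\in\mathbb{C}^{n^2\times m}$, $m=n(n+1)/2$, is defined by $$L'=\big(\operatorname{vec}(\mathcal{L}(\operatorname{vech}^{-1}(e_1))),\ldots,\operatorname{vec}(\mathcal{L}(\operatorname{vech}^{-1}(e_m)))\big),$$ with $e_1,\ldots,e_m$ the columns of the identity matrix $I_m$.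
   Context: $M\subset\mathbb{C}^{n\times n}$ is the set of Hermitian matrices, $1\le p<n$. $A:M\to M$ has the form $A(P)=A_0+\mathcal{L}(P)$, where $A_0\in M$ and $\mathcal{L}:\mathbb{C}^{n\times n}\to\mathbb{C}^{n\times n}$ is complex linear. The SCF map $\Psi$: for $P\in M$ (such that the $p$-th and $(p+1)$-th smallest eigenvalues of $A(P)$ differ), $\Psi(P)=VV^H$, where $V\in\mathbb{C}^{n\times p}$ has orthonormal columns that are eigenvectors of $A(P)$ for its $p$ smallest eigenvalues. The SCF iteration is $P_{k+1}=\Psi(P_k)$. $\operatorname{vec}$ is column-stacking vectorization, $\otimes$ is the Kronecker product, $\overline{X}$ is entrywise complex conjugation, $X^T$ the transpose, $X^H$ the conjugate transpose. With $m=n(n+1)/2$, $\operatorname{vech}(W)=[w_{1,1},\ldots,w_{n,1},w_{2,2},\ldots,w_{n,2},w_{3,3},\ldots,w_{n,n}]^T\in\mathbb{C}^m$ stacks the columns of the lower triangular part (including the diagonal) of $W$; $\operatorname{vech}^{-1}$ is the inverse operator mapping a vector to the corresponding Hermitian matrix (so $\operatorname{vech}^{-1}(e_j)$ is the real symmetric matrix whose lower triangular part is given by $e_j$). $T\in\mathbb{R}^{m\times n^2}$ is the block diagonal matrix $T=\mathrm{diag}(I_n,[0\; I_{n-1}],[0\;0\;I_{n-2}],\ldots,[0\cdots 0\;1])$, whose $k$-th block is of size $(n-k+1)\times n$; it satisfies $\operatorname{vech}(W)=T\operatorname{vec}(W)$. The reciprocal gap matrix $R\in\mathbb{R}^{n\times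 n}$ is $R_{i,j}=\frac{1}{\lambda_j-\lambda_i}$ if $i\le p<j$, $R_{i,j}=\frac{1}{\lambda_i-\lambda_j}$ if $j\le p<i$, and $R_{i,j}=0$ otherwise, where $\lambda_1\le\cdots\le\lambda_n$ are the eigenvalues of $A(P_* )$. $D=\mathrm{diag}(\operatorname{vec}(R))\in\mathbb{R}^{n^2\times n^2}$.
   Formalization: The expansion with J_P as printed fails for non-real Hermitian P_k − P_*; it is proved when P_k − P_* has real entries, and for all Hermitian P_k with L' vech(P_k − P_* ) replaced by vec(L(P_k − P_* )). *)

theory Defs
  imports "Jordan_Normal_Form.Schur_Decomposition" "HOL-Analysis.L2_Norm"
begin

text \<open>
  Indices are 0-based throughout: \<open>lam 0 \<le> \<dots> \<le> lam (n - 1)\<close> are the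
  eigenvalues written \<open>\<lambda>\<^sub>1 \<le> \<dots> \<le> \<lambda>\<^sub>n\<close> on paper, so that the gap between the \<open>p\<close>-th and
  the \<open>(p+1)\<close>-th one is the gap between \<open>lam (p - 1)\<close> and \<open>lam p\<close>.
\<close>

definition cnorm :: "complex vec \<Rightarrow> real" where
  "cnorm v = L2_set (\<lambda>i. cmod (v $ i)) {..<dim_vec v}"

definition hermitian_mats :: "nat \<Rightarrow> complex mat set" where
  "hermitian_mats n = {W \<in> carrier_mat n n. mat_adjoint W = W}"

definition complex_linear_on_mats :: "nat \<Rightarrow> (complex mat \<Rightarrow> complex mat) \<Rightarrow> bool" where
  "complex_linear_on_mats n L \<longleftrightarrow>
     (\<forall>U \<in> carrier_mat n n. L U \<in> carrier_mat n n) \<and>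
     (\<forall>U \<in> carrier_mat n n. \<forall>W \<in> carrier_mat n n. L (U + W) = L U + L W) \<and>
     (\<forall>c. \<forall>U \<in> carrier_mat n n. L (c \<cdot>\<^sub>m U) = c \<cdot>\<^sub>m L U)"

text \<open>
  The ascending list of eigenvalues, repeated by multiplicity. It is only used for
  Hermitian matrices, where the roots of the characteristic polynomial are real and
  taking real parts loses nothing.
\<close>

definition sorted_eigvals :: "complex mat \<Rightarrow> real list" where
  "sorted_eigvals H = sorted_list_of_multiset (image_mset Re (proots (char_poly H)))"

definition lowest_eigbasis :: "nat \<Rightarrow> nat \<Rightarrow> complex mat \<Rightarrow> complex mat \<Rightarrow> bool" where
  "lowest_eigbasis n p H V \<longleftrightarrow>
     V \<in> carrier_mat n p \<and> mat_adjoint V * V = 1\<^sub>m p \<and>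
     (\<forall>i<p. eigenvector H (col V i) (complex_of_real (sorted_eigvals H ! i)))"

definition scf_domain :: "nat \<Rightarrow> nat \<Rightarrow> (complex mat \<Rightarrow> complex mat) \<Rightarrow> complex mat set" where
  "scf_domain n p A =
     {P \<in> hermitian_mats n. sorted_eigvals (A P) ! (p - 1) \<noteq> sorted_eigvals (A P) ! p}"

text \<open>
  On \<^const>\<open>scf_domain\<close> the product \<open>V V\<^sup>H\<close> does not depend on the chosen basis \<open>V\<close>;
  outside of it the value is meaningless.
\<close>

definition scf_map ::
  "nat \<Rightarrow> nat \<Rightarrow> (complex mat \<Rightarrow> complex mat) \<Rightarrow> complex mat \<Rightarrow> complex mat" where
  "scf_map n p A P = (let V = (SOME V. lowest_eigbasis n p (A P) V) in V * mat_adjoint V)"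

definition vec_op :: "complex mat \<Rightarrow> complex vec" where
  "vec_op W = vec_of_list (concat (map list_of_vec (cols W)))"

definition vech :: "complex mat \<Rightarrow> complex vec" where
  "vech W =
     vec_of_list (concat (map (\<lambda>j. map (\<lambda>i. W $$ (i, j)) [j..<dim_row W]) [0..<dim_col W]))"

text \<open>
  On Hermitian matrices \<^const>\<open>vech\<close> is injective; its range consists of the vectors whose
  entries in diagonal positions are real. It is only real linear there: for a general
  Hermitian \<open>W\<close>, \<open>W\<close> is not \<open>\<Sum>j. vech W $ j \<cdot> vech_inv n (e\<^sub>j)\<close>, which is complex symmetric.
\<close>

definition vech_inv :: "nat \<Rightarrow> complex vec \<Rightarrow> complex mat" where
  "vech_inv n = inv_into (hermitian_mats n) vech"

definition kron :: "complex mat \<Rightarrow> complex mat \<Rightarrow> complex mat" where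
  "kron U W = mat (dim_row U * dim_row W) (dim_col U * dim_col W)
     (\<lambda>(i, j). U $$ (i div dim_row W, j div dim_col W) * W $$ (i mod dim_row W, j mod dim_col W))"

definition T_mat :: "nat \<Rightarrow> complex mat" where
  "T_mat n = diag_block_mat (map (\<lambda>k. mat (n - k) n (\<lambda>(i, j). if j = k + i then 1 else 0)) [0..<n])"

definition R_mat :: "nat \<Rightarrow> nat \<Rightarrow> (nat \<Rightarrow> real) \<Rightarrow> complex mat" where
  "R_mat n p lam = mat n n (\<lambda>(i, j). complex_of_real
     (if i < p \<and> p \<le> j then 1 / (lam j - lam i)
      else if j < p \<and> p \<le> i then 1 / (lam i - lam j)
      else 0))"

definition D_mat :: "nat \<Rightarrow> nat \<Rightarrow> (nat \<Rightarrow> real) \<Rightarrow> complex mat" where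
  "D_mat n p lam = mat_diag (n * n) (\<lambda>k. vec_op (R_mat n p lam) $ k)"

definition L_prime :: "nat \<Rightarrow> (complex mat \<Rightarrow> complex mat) \<Rightarrow> complex mat" where
  "L_prime n L = mat_of_cols (n * n)
     (map (\<lambda>j. vec_op (L (vech_inv n (unit_vec (n * (n + 1) div 2) j)))) [0..<n * (n + 1) div 2])"

text \<open>The factor of \<open>J\<^sub>P\<close> to the left of \<open>L'\<close>.\<close>

definition response_mat :: "nat \<Rightarrow> nat \<Rightarrow> complex mat \<Rightarrow> (nat \<Rightarrow> real) \<Rightarrow> complex mat" where
  "response_mat n p X lam =
     - T_mat n * kron (map_mat cnj X) X * D_mat n p lam * kron (transpose_mat X) (mat_adjoint X)"

definition J_mat ::
  "nat \<Rightarrow> nat \<Rightarrow> complex mat \<Rightarrow> (nat \<Rightarrow> real) \<Rightarrow> (complex mat \<Rightarrow> complex mat) \<Rightarrow> complex mat" where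
  "J_mat n p X lam L = response_mat n p X lam * L_prime n L"

end

theory Submission
  imports Defs
begin

text \<open>
  Write \<open>H = A(P\<^sub>*)\<close>, \<open>E = \<L>(P\<^sub>k - P\<^sub>*)\<close> and \<open>Q = \<Psi>(P\<^sub>k)\<close>. By Ky Fan's minimum principle
  \<open>Q\<close> minimises \<open>tr ((H + E) Q)\<close> among the rank-\<open>p\<close> orthogonal projectors. Comparing \<open>Q\<close> with \<open>P\<^sub>*\<close>, and
  using that the gap \<open>g\<close> of \<open>H\<close> gives \<open>tr (H Q) - tr (H P\<^sub>*) \<ge> g \<parallel>Q - P\<^sub>*\<parallel>\<^sup>2 / 2\<close> in the Frobenius norm,
  yields \<open>\<parallel>Q - P\<^sub>*\<parallel> = O(\<parallel>E\<parallel>)\<close> with no smallness condition on \<open>E\<close>. In an eigenbasis of \<open>H\<close>,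
  \<open>Q\<^sup>2 = Q\<close> makes the diagonal blocks of \<open>Q - P\<^sub>*\<close> quadratic in \<open>Q - P\<^sub>*\<close>, and the off-diagonal
  entries of \<open>[H + E, Q] = 0\<close> can be solved for those of \<open>Q\<close>, which produces the reciprocal gaps.
\<close>

subsection \<open>Spectral theorem for Hermitian matrices\<close>

text \<open>The two-part conclusion is forced by \<open>L_prime\<close>: it is built from the
  symmetric matrices \<open>vech_inv n e_j\<close> and acts complex linearly. Thus
  \<open>L_prime n L *\<^sub>v vech W\<close> is the vectorization of \<open>L S\<close>, where
  \<open>S\<close> is the complex symmetric matrix with the lower triangle of \<open>W\<close>; for
  Hermitian \<open>W\<close> one has \<open>S = W\<close> only if \<open>W\<close> is real. So the
  estimate with \<open>J_mat\<close> is stated for real differences, and the one with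
  \<open>response_mat\<close> applied to \<open>vec_op (L (P k - Pstar))\<close> for all Hermitian
  iterates. The variational route is natural because \<open>scf_map\<close> is known only through
  eigenvector equations for \<open>sorted_eigvals (A P)\<close>: comparing traces requires no
  control of how these eigenvalues move with \<open>P\<close>. Commutation alone cannot bound the
  diagonal blocks, where differences of eigenvalues may vanish; idempotence takes over there. The
  powers of \<open>n\<close> in the constants come from working with entrywise bounds.\<close>

lemma mat_adjoint_dim [simp]:
  "dim_row (mat_adjoint A) = dim_col A" "dim_col (mat_adjoint A) = dim_row A"
  by (simp_all add: mat_adjoint_def)

lemma mat_adjoint_carrier [simp]:
  "mat_adjoint A \<in> carrier_mat n m \<longleftrightarrow> A \<in> carrier_mat m n"
  unfolding carrier_mat_def by (simp add: conj_commute)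

lemma mat_adjoint_index [simp]:
  fixes A :: "complex mat"
  assumes "i < dim_col A" "j < dim_row A"
  shows "mat_adjoint A $$ (i, j) = cnj (A $$ (j, i))"
  using assms by (simp add: mat_adjoint_def mat_of_rows_def conjugate_vec_def conjugate_complex_def)

lemma mat_adjoint_adjoint [simp]: "mat_adjoint (mat_adjoint (A :: complex mat)) = A"
  by (rule eq_matI) auto

lemma mult_mat_index:
  assumes "A \<in> carrier_mat a b" "B \<in> carrier_mat b c" "i < a" "j < c"
  shows "(A * B) $$ (i, j) = (\<Sum>k<b. A $$ (i, k) * B $$ (k, j))"
  using assms by (simp add: scalar_prod_def lessThan_atLeast0)

lemma mat_adjoint_mult:
  fixes A B :: "complex mat"
  assumes "A \<in> carrier_mat a b" "B \<in> carrier_mat b c"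
  shows "mat_adjoint (A * B) = mat_adjoint B * mat_adjoint A"
proof (rule eq_matI)
  fix i j assume "i < dim_row (mat_adjoint B * mat_adjoint A)" "j < dim_col (mat_adjoint B * mat_adjoint A)"
  then have ij: "i < c" "j < a" using assms by auto
  have "mat_adjoint (A * B) $$ (i, j) = cnj (\<Sum>k<b. A $$ (j, k) * B $$ (k, i))"
    using assms ij by (subst mat_adjoint_index) (auto simp: mult_mat_index simp del: index_mult_mat(1))
  also have "\<dots> = (\<Sum>k<b. mat_adjoint B $$ (i, k) * mat_adjoint A $$ (k, j))"
    unfolding cnj_sum using assms ij by (intro sum.cong) auto
  also have "\<dots> = (mat_adjoint B * mat_adjoint A) $$ (i, j)"
    using assms ij by (intro mult_mat_index[symmetric]) auto
  finally show "mat_adjoint (A * B) $$ (i, j) = (mat_adjoint B * mat_adjoint A) $$ (i, j)" .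
qed (use assms in auto)

lemma hermitian_index:
  assumes "A \<in> hermitian_mats n" "i < n" "j < n"
  shows "A $$ (i, j) = cnj (A $$ (j, i))"
  using assms mat_adjoint_index[of i A j] by (auto simp: hermitian_mats_def)

lemma hermitian_carrier: "A \<in> hermitian_mats n \<Longrightarrow> A \<in> carrier_mat n n"
  by (simp add: hermitian_mats_def)

lemma hermitianI:
  assumes "A \<in> carrier_mat n n" "\<And>i j. i < n \<Longrightarrow> j < n \<Longrightarrow> A $$ (i, j) = cnj (A $$ (j, i))"
  shows "A \<in> hermitian_mats n"
  using assms(1) assms(2)[symmetric] by (auto simp: hermitian_mats_def intro!: eq_matI)

lemma hermitian_conj:
  assumes "A \<in> hermitian_mats n" "W \<in> carrier_mat n m"
  shows "mat_adjoint W * A * W \<in> hermitian_mats m"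
proof -
  have A: "A \<in> carrier_mat n n" "mat_adjoint A = A" using assms(1) by (auto simp: hermitian_mats_def)
  have "mat_adjoint (mat_adjoint W * A * W) = mat_adjoint W * (A * W)"
    using A assms(2) mat_adjoint_mult[of "mat_adjoint W * A" m n W m]
      mat_adjoint_mult[of "mat_adjoint W" m n A n] by simp
  also have "\<dots> = mat_adjoint W * A * W"
    using A assms(2) by (intro assoc_mult_mat[symmetric, of _ m n _ n _ m]) auto
  finally show ?thesis using A assms(2) by (auto simp: hermitian_mats_def)
qed

text \<open>Gram-Schmidt keeps its first vector and returns orthogonal, unnormalised vectors.
  Dividing each by its norm rescales \<open>v\<close> as well, hence the factor
  \<open>c\<close>.\<close>

lemma orthonormal_completion:
  fixes v :: "complex vec"
  assumes v: "v \<in> carrier_vec n" "v \<noteq> 0\<^sub>v n" and n: "n \<noteq> 0"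
  shows "\<exists>W c. W \<in> carrier_mat n n \<and> mat_adjoint W * W = 1\<^sub>m n \<and> col W 0 = c \<cdot>\<^sub>v v"
proof -
  interpret cof_vec_space n "TYPE(complex)" .
  define b where "b = basis_completion v"
  define ws where "ws = gram_schmidt n b"
  from basis_completion[OF v, folded b_def]
  have dist_b: "distinct b" and indep: "\<not> lin_dep (set b)" and b: "set b \<subseteq> carrier_vec n" and hdb: "hd b = v" 
    and len_b: "length b = n" by auto
  from hdb len_b n obtain vs where bv: "b = v # vs" by (cases b, auto)
  from gram_schmidt_result[OF b dist_b indep refl, folded ws_def]
  have ws: "set ws \<subseteq> carrier_vec n" "corthogonal ws" "length ws = n" 
    by (auto simp: len_b)
  from gram_schmidt_hd[OF v(1), of vs, folded bv] have hdws: "hd ws = v" unfolding ws_def .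
  define nm :: "nat \<Rightarrow> real" where "nm i = sqrt (\<Sum>k<n. (cmod (ws ! i $ k))\<^sup>2)" for i
  have wsc: "ws ! i \<in> carrier_vec n" if "i < n" for i using that ws by auto
  have self: "(\<Sum>k<n. cnj (ws ! i $ k) * ws ! i $ k) = complex_of_real ((nm i)\<^sup>2)" for i
    by (simp add: nm_def sum_nonneg complex_norm_square mult.commute del: of_real_power)
  have sp: "ws ! i \<bullet>c ws ! j = (\<Sum>k<n. cnj (ws ! j $ k) * ws ! i $ k)" if "i < n" "j < n" for i j
    using wsc[OF that(1)] wsc[OF that(2)]
    by (simp add: scalar_prod_def lessThan_atLeast0 conjugate_complex_def mult.commute)
  \<comment> \<open>\<open>corthogonal\<close> asserts, besides orthogonality, that no vector has a
    vanishing inner product with itself; the latter is used here.\<close>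
  have nz: "nm i \<noteq> 0" if "i < n" for i
    using corthogonalD[OF ws(2), of i i] sp[OF that that] that ws(3) self[of i] by auto
  define W where "W = mat n n (\<lambda>(k, i). ws ! i $ k / nm i)"
  have W: "W \<in> carrier_mat n n" by (simp add: W_def)
  have "mat_adjoint W * W = 1\<^sub>m n"
  proof (rule eq_matI)
    fix i j assume "i < dim_row (1\<^sub>m n :: complex mat)" "j < dim_col (1\<^sub>m n :: complex mat)"
    then have ij: "i < n" "j < n" by auto
    have "(mat_adjoint W * W) $$ (i, j) = (\<Sum>k<n. cnj (ws ! i $ k / nm i) * (ws ! j $ k / nm j))"
      unfolding mult_mat_index[OF iffD2[OF mat_adjoint_carrier W] W ij]
      using ij by (intro sum.cong) (auto simp: W_def)
    also have "\<dots> = (\<Sum>k<n. cnj (ws ! i $ k) * ws ! j $ k) / (nm i * nm j)"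
      by (simp add: sum_divide_distrib)
    also have "\<dots> = (if i = j then 1 else 0)"
      using corthogonalD[OF ws(2), of j i] sp[OF ij(2,1)] ij ws(3) self[of i] nz[OF ij(1)]
      by (auto simp: power2_eq_square)
    finally show "(mat_adjoint W * W) $$ (i, j) = 1\<^sub>m n $$ (i, j)" using ij by simp
  qed (use W in auto)
  moreover have "col W 0 = (1 / nm 0) \<cdot>\<^sub>v v"
  proof -
    have "ws \<noteq> []" using ws(3) n by auto
    then have "ws ! 0 = v" using hdws by (simp add: hd_conv_nth)
    then show ?thesis using n v(1) by (intro eq_vecI) (auto simp: W_def)
  qed
  ultimately show ?thesis using W by blast
qed

lemma prod_list_linear_nonzero: "(\<Prod>e\<leftarrow>es. [:- e, 1:]) \<noteq> (0 :: complex poly)"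
proof -
  have "monic (\<Prod>e\<leftarrow>es. [:- e, 1:])" by (rule monic_prod_list) auto
  then show ?thesis by (metis coeff_0 zero_neq_one)
qed

lemma char_poly_prod_length:
  assumes "(A :: complex mat) \<in> carrier_mat n n" "char_poly A = (\<Prod>e\<leftarrow>es. [:- e, 1:])"
  shows "length es = n"
proof -
  have "degree (\<Prod>e\<leftarrow>es. [:- e, 1:]) = length es"
  proof (induction es)
    case (Cons e es)
    then show ?case using prod_list_linear_nonzero[of es] by (simp add: degree_mult_eq del: mult_pCons_left)
  qed simp
  then show ?thesis using degree_monic_char_poly[OF assms(1)] assms(2) by simp
qed

text \<open>Deflation: an eigenvector for the head of \<open>es\<close> becomes the first column of
  a unitary \<open>W\<close>, and the rest of the list is realised on the complementary block. Since
  \<open>es\<close> may be any ordering of the roots, the order on the diagonal can be prescribed,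
  which \<open>hermitian_sorted_eigbasis\<close> exploits.\<close>

lemma hermitian_unitary_diagonalization:
  assumes "A \<in> hermitian_mats n" "char_poly A = (\<Prod>e\<leftarrow>es. [:- e, 1:])"
  shows "\<exists>U \<in> carrier_mat n n. mat_adjoint U * U = 1\<^sub>m n \<and>
    mat_adjoint U * A * U = mat_diag n (\<lambda>i. es ! i)"
  using assms
proof (induction es arbitrary: n A)
  case Nil
  then have "n = 0" using char_poly_prod_length[of A n "[]"] by (auto simp: hermitian_mats_def)
  then show ?case using Nil by (intro bexI[of _ "1\<^sub>m 0"]) (auto simp: hermitian_mats_def mat_diag_def)
next
  case (Cons e es)
  have A: "A \<in> carrier_mat n n" using Cons.prems by (simp add: hermitian_mats_def)
  have n: "n = Suc (length es)" using char_poly_prod_length[OF A Cons.prems(2)] by simp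
  have "eigenvalue A e" unfolding eigenvalue_root_char_poly[OF A] Cons.prems(2) by simp
  then obtain v where v: "v \<in> carrier_vec n" "v \<noteq> 0\<^sub>v n" "A *\<^sub>v v = e \<cdot>\<^sub>v v"
    using A by (auto simp: eigenvalue_def eigenvector_def)
  obtain W c where W: "W \<in> carrier_mat n n" "mat_adjoint W * W = 1\<^sub>m n" "col W 0 = c \<cdot>\<^sub>v v"
    using orthonormal_completion[OF v(1,2)] n by auto
  have WW: "W * mat_adjoint W = 1\<^sub>m n"
    using mat_mult_left_right_inverse[OF _ W(1) W(2)] W(1) by simp
  let ?B = "mat_adjoint W * A * W" and ?m = "length es"
  have B: "?B \<in> hermitian_mats n" by (rule hermitian_conj[OF Cons.prems(1) W(1)])
  then have Bc: "?B \<in> carrier_mat n n" by (simp add: hermitian_mats_def)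
  have "col ?B 0 = mat_adjoint W *\<^sub>v (A *\<^sub>v col W 0)"
  proof -
    have W': "mat_adjoint W \<in> carrier_mat n n" using W(1) by simp
    have w: "col W 0 \<in> carrier_vec n" using W(1) by (simp add: carrier_vecI)
    have "col ?B 0 = mat_adjoint W * A *\<^sub>v col W 0"
      by (rule col_mult2[OF mult_carrier_mat[OF W' A] W(1)]) (simp add: n)
    then show ?thesis using assoc_mult_mat_vec[OF W' A w] by simp
  qed
  also have "A *\<^sub>v col W 0 = e \<cdot>\<^sub>v col W 0"
    using A v W(1) unfolding W(3) by (simp add: mult_mat_vec smult_smult_assoc mult.commute)
  also have "mat_adjoint W *\<^sub>v (e \<cdot>\<^sub>v col W 0) = e \<cdot>\<^sub>v (mat_adjoint W *\<^sub>v col W 0)"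
    using W(1) by (intro mult_mat_vec[of _ n n]) (auto simp: carrier_vecI)
  also have "mat_adjoint W *\<^sub>v col W 0 = col (mat_adjoint W * W) 0"
    using W(1) n by (intro col_mult2[symmetric]) auto
  also have "\<dots> = unit_vec n 0" using W n by simp
  finally have B0: "?B $$ (i, 0) = (if i = 0 then e else 0)" if "i < n" for i
    using that n Bc index_col[of i ?B 0] by (auto simp: unit_vec_def)
  \<comment> \<open>Hermitian symmetry turns the cleared first column into a cleared first row, so
    the matrix splits into diagonal blocks instead of being merely block triangular.\<close>
  have B0': "?B $$ (0, i) = 0" if "0 < i" "i < n" for i
    using hermitian_index[OF B _ that(2), of 0] B0[OF that(2)] that by auto
  define A3 where "A3 = mat ?m ?m (\<lambda>(i, j). ?B $$ (Suc i, Suc j))"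
  define A1 where "A1 = mat 1 1 (\<lambda>_. e)"
  have c1: "A3 \<in> carrier_mat ?m ?m" "A1 \<in> carrier_mat 1 1" by (auto simp: A3_def A1_def)
  have blk: "?B = four_block_mat A1 (0\<^sub>m 1 ?m) (0\<^sub>m ?m 1) A3"
    by (rule eq_matI) (use Bc B0 B0' n in \<open>auto simp: A1_def A3_def four_block_mat_def Let_def less_Suc_eq_0_disj\<close>)
  \<comment> \<open>Similarity preserves the characteristic polynomial, so cancelling the linear
    factor of the 1 by 1 block leaves exactly the product over the tail, as the induction hypothesis
    requires.\<close>
  have "similar_mat ?B A"
    by (rule similar_matI[of _ _ "mat_adjoint W" W n]) (use A W WW in auto)
  then have "[:- e, 1:] * (\<Prod>e\<leftarrow>es. [:- e, 1:]) = char_poly ?B"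
    using char_poly_similar Cons.prems(2) by (metis list.simps(9) prod_list.Cons)
  also have "\<dots> = char_poly A1 * char_poly A3"
    unfolding blk by (rule char_poly_four_block_zeros_col) (use c1 in auto)
  also have "char_poly A1 = [:- e, 1:]"
    by (simp add: A1_def char_poly_defs det_def sign_def)
  finally have cp: "char_poly A3 = (\<Prod>e\<leftarrow>es. [:- e, 1:])"
    by (metis mult_cancel_left pCons_eq_0_iff zero_neq_one)
  have "A3 \<in> hermitian_mats ?m"
  proof (rule hermitianI)
    fix i j assume ij: "i < ?m" "j < ?m"
    then show "A3 $$ (i, j) = cnj (A3 $$ (j, i))"
      using hermitian_index[OF B, of "Suc i" "Suc j"] n by (simp only: A3_def index_mat split)
  qed (rule c1)
  from Cons.IH[OF this cp] obtain U where U: "U \<in> carrier_mat ?m ?m"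
    "mat_adjoint U * U = 1\<^sub>m ?m" "mat_adjoint U * A3 * U = mat_diag ?m (\<lambda>i. es ! i)" by blast
  \<comment> \<open>The unitary matrix for the whole of \<open>A\<close> is \<open>W\<close> times
    the extension of \<open>U\<close> by a leading 1.\<close>
  let ?V = "four_block_mat (1\<^sub>m 1) (0\<^sub>m 1 ?m) (0\<^sub>m ?m 1) U"
  let ?V' = "four_block_mat (1\<^sub>m 1) (0\<^sub>m 1 ?m) (0\<^sub>m ?m 1) (mat_adjoint U)"
  have V: "?V \<in> carrier_mat n n" "?V' \<in> carrier_mat n n"
    using four_block_carrier_mat[OF one_carrier_mat[of 1] U(1)]
      four_block_carrier_mat[OF one_carrier_mat[of 1], of "mat_adjoint U" ?m] U(1) n by auto
  have V': "mat_adjoint ?V = ?V'"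
    by (rule eq_matI) (use U(1) in \<open>auto simp: four_block_mat_def Let_def\<close>)
  have VV: "?V' * ?V = 1\<^sub>m n"
    using U n by (subst mult_four_block_mat[of _ 1 1 _ ?m _ ?m _ _ 1 _ ?m]) auto
  have "?V' * ?B * ?V = four_block_mat A1 (0\<^sub>m 1 ?m) (0\<^sub>m ?m 1) (mat_adjoint U * A3 * U)"
    unfolding blk using U c1
    by (simp add: mult_four_block_mat[of _ 1 1 _ ?m _ ?m _ _ 1 _ ?m])
  also have "\<dots> = mat_diag n (\<lambda>i. (e # es) ! i)"
    by (rule eq_matI) (use c1 n U in \<open>auto simp: mat_diag_def A1_def nth_Cons' four_block_mat_def Let_def\<close>)
  finally have VBV: "?V' * ?B * ?V = mat_diag n (\<lambda>i. (e # es) ! i)" .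
  have adj: "mat_adjoint (W * ?V) = ?V' * mat_adjoint W"
    using mat_adjoint_mult[OF W(1) V(1)] V' by simp
  have W': "mat_adjoint W \<in> carrier_mat n n" using W by simp
  have "mat_adjoint (W * ?V) * (W * ?V) = ?V' * (mat_adjoint W * (W * ?V))"
    unfolding adj using W(1) W' V by (simp add: assoc_mult_mat[of _ n n _ n _ n])
  also have "mat_adjoint W * (W * ?V) = ?V"
    using assoc_mult_mat[OF W' W(1) V(1)] left_mult_one_mat[OF V(1)] unfolding W(2) by (rule trans[OF sym])
  finally have "mat_adjoint (W * ?V) * (W * ?V) = 1\<^sub>m n" using VV by simp
  moreover have "mat_adjoint (W * ?V) * A * (W * ?V) = ?V' * ?B * ?V"
    unfolding adj using A W(1) W' V by (simp add: assoc_mult_mat[of _ n n _ n _ n])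
  ultimately show ?case using VBV W(1) V by (intro bexI[of _ "W * ?V"]) auto
qed

text \<open>The diagonalization is applied twice. With the roots in arbitrary order it shows that
  they are real, being diagonal entries of a Hermitian matrix; hence
  \<open>sorted_eigvals A\<close>, embedded in the complex numbers, is a permutation of the roots.
  The product of linear factors depends only on the multiset, so the second application may use the
  sorted list.\<close>

lemma hermitian_sorted_eigbasis:
  assumes "A \<in> hermitian_mats n"
  shows "\<exists>U \<in> carrier_mat n n. mat_adjoint U * U = 1\<^sub>m n \<and>
    mat_adjoint U * A * U = mat_diag n (\<lambda>i. complex_of_real (sorted_eigvals A ! i))"
    and "length (sorted_eigvals A) = n" "sorted (sorted_eigvals A)"
proof -
  have A: "A \<in> carrier_mat n n" using assms by (simp add: hermitian_mats_def)
  obtain as where as: "char_poly A = (\<Prod>a\<leftarrow>as. [:- a, 1:])" "length as = n"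
    using char_poly_factorized[OF A] by blast
  obtain U where U: "U \<in> carrier_mat n n" 
     "mat_adjoint U * A * U = mat_diag n (\<lambda>i. as ! i)"
    using hermitian_unitary_diagonalization[OF assms as(1)] by blast
  have real: "complex_of_real (Re (as ! i)) = as ! i" if "i < n" for i
    using hermitian_index[OF hermitian_conj[OF assms U(1)] that that] that
    unfolding U(2) by (auto simp: mat_diag_def complex_eq_iff)
  have pr: "proots (char_poly A) = mset as"
  proof -
    have "proots (\<Prod>a\<leftarrow>as. [:- a, 1:]) = mset as"
    proof (induction as)
      case (Cons a as)
      then show ?case
        using prod_list_linear_nonzero[of as] by (simp add: proots_mult del: mult_pCons_left)
    qed simp
    then show ?thesis by (simp add: as(1))
  qed
  let ?s = "sorted_eigvals A"
  have ms: "mset ?s = mset (map Re as)"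
    by (simp add: sorted_eigvals_def pr)
  then show "length ?s = n" by (metis as(2) length_map size_mset)
  show "sorted ?s" by (simp add: sorted_eigvals_def)
  have "map (complex_of_real \<circ> Re) as = as" using real as(2) by (intro nth_equalityI) auto
  then have ms': "mset (map complex_of_real ?s) = mset as"
    by (metis ms mset_map map_map)
  have pm: "(\<Prod>e\<leftarrow>xs. [:- e, 1:]) = (\<Prod>e\<in>#mset xs. [:- e, 1:])" for xs :: "complex list"
    by (simp add: prod_mset_prod_list flip: mset_map)
  have "(\<Prod>e\<leftarrow>map complex_of_real ?s. [:- e, 1:]) = (\<Prod>e\<leftarrow>as. [:- e, 1:])"
    using pm[of "map complex_of_real ?s"] pm[of as] unfolding ms' by simp
  then obtain U where U: "U \<in> carrier_mat n n" "mat_adjoint U * U = 1\<^sub>m n"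
     "mat_adjoint U * A * U = mat_diag n (\<lambda>i. map complex_of_real ?s ! i)"
    using hermitian_unitary_diagonalization[OF assms, of "map complex_of_real ?s"] as by auto
  have "mat_diag n (\<lambda>i. map complex_of_real ?s ! i) = mat_diag n (\<lambda>i. complex_of_real (?s ! i))"
    using \<open>length ?s = n\<close> by (intro eq_matI) (auto simp: mat_diag_def)
  with U show "\<exists>U \<in> carrier_mat n n. mat_adjoint U * U = 1\<^sub>m n \<and>
    mat_adjoint U * A * U = mat_diag n (\<lambda>i. complex_of_real (?s ! i))" by auto
qed

subsection \<open>Orthogonal projectors and Ky Fan's minimum principle\<close>

definition mat_trace :: "nat \<Rightarrow> complex mat \<Rightarrow> complex" where
  "mat_trace n A = (\<Sum>i<n. A $$ (i, i))"

text \<open>The rank of the projector is encoded by its trace, the form in which it enters the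
  weight arguments below.\<close>

definition orth_projector :: "nat \<Rightarrow> nat \<Rightarrow> complex mat \<Rightarrow> bool" where
  "orth_projector n p Q \<longleftrightarrow> Q \<in> hermitian_mats n \<and> Q * Q = Q \<and> mat_trace n Q = of_nat p"

lemma mat_trace_mult_commute:
  assumes "A \<in> carrier_mat n m" "B \<in> carrier_mat m n"
  shows "mat_trace n (A * B) = mat_trace m (B * A)"
proof -
  have "mat_trace n (A * B) = (\<Sum>i<n. \<Sum>k<m. A $$ (i, k) * B $$ (k, i))"
    unfolding mat_trace_def using assms by (intro sum.cong mult_mat_index) auto
  also have "\<dots> = (\<Sum>k<m. \<Sum>i<n. B $$ (k, i) * A $$ (i, k))"
    by (subst sum.swap) (simp add: mult.commute)
  also have "\<dots> = mat_trace m (B * A)"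
    unfolding mat_trace_def using assms by (intro sum.cong mult_mat_index[symmetric]) auto
  finally show ?thesis .
qed

lemma mat_trace_add:
  assumes "A \<in> carrier_mat n n" "B \<in> carrier_mat n n"
  shows "mat_trace n (A + B) = mat_trace n A + mat_trace n B"
  using assms by (simp add: mat_trace_def sum.distrib)

lemma conj_mult:
  assumes U: "U \<in> carrier_mat n n" "U * mat_adjoint U = 1\<^sub>m n"
    and A: "A \<in> carrier_mat n n" and B: "B \<in> carrier_mat n n"
  shows "mat_adjoint U * A * U * (mat_adjoint U * B * U) = mat_adjoint U * (A * B) * U"
proof -
  have U': "mat_adjoint U \<in> carrier_mat n n" using U by simp
  have "U * (mat_adjoint U * (B * U)) = B * U"
    using assoc_mult_mat[OF U(1) U', of "B * U" n] left_mult_one_mat[of "B * U" n n] U B by auto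
  then show ?thesis
    using U U' A B by (simp add: assoc_mult_mat[of _ n n _ n _ n])
qed

lemma mat_trace_conj:
  assumes U: "U \<in> carrier_mat n n" "U * mat_adjoint U = 1\<^sub>m n" and A: "A \<in> carrier_mat n n"
  shows "mat_trace n (mat_adjoint U * A * U) = mat_trace n A"
proof -
  have U': "mat_adjoint U \<in> carrier_mat n n" using U by simp
  have "mat_trace n (mat_adjoint U * A * U) = mat_trace n (U * (mat_adjoint U * A))"
    by (rule mat_trace_mult_commute) (use U U' A in auto)
  also have "U * (mat_adjoint U * A) = A"
    using assoc_mult_mat[OF U(1) U' A] left_mult_one_mat[OF A] U(2) by simp
  finally show ?thesis .
qed

lemma orth_projector_conj:
  assumes "U \<in> carrier_mat n n" "U * mat_adjoint U = 1\<^sub>m n" "orth_projector n p Q"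
  shows "orth_projector n p (mat_adjoint U * Q * U)"
  using assms conj_mult[of U n Q Q] mat_trace_conj[of U n Q] hermitian_conj[of Q n U n]
  by (auto simp: orth_projector_def hermitian_carrier)

lemma orth_projector_orthonormal:
  assumes V: "V \<in> carrier_mat n p" "mat_adjoint V * V = 1\<^sub>m p"
  shows "orth_projector n p (V * mat_adjoint V)"
proof -
  have V': "mat_adjoint V \<in> carrier_mat p n" using V by simp
  have "V * mat_adjoint V \<in> hermitian_mats n"
    using mat_adjoint_mult[OF V(1) V'] V by (simp add: hermitian_mats_def)
  moreover have "mat_adjoint V * (V * mat_adjoint V) = mat_adjoint V"
    using assoc_mult_mat[OF V' V(1) V'] left_mult_one_mat[OF V'] V(2) by simp
  then have "V * mat_adjoint V * (V * mat_adjoint V) = V * mat_adjoint V"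
    using assoc_mult_mat[OF V(1) V', of "V * mat_adjoint V" n] V V' by simp
  moreover have "mat_trace n (V * mat_adjoint V) = of_nat p"
    using mat_trace_mult_commute[OF V(1) V'] V(2) by (simp add: mat_trace_def)
  ultimately show ?thesis by (simp add: orth_projector_def)
qed

text \<open>The diagonal of \<open>Q = Q * Q\<close> with \<open>Q\<close> Hermitian gives the row
  sums of squares. One summand is the square of the diagonal entry itself, so that entry is at least
  its own square and thus at most 1. These entries serve as the weights \<open>q\<close> of
  \<open>weighted_sum_gap\<close>.\<close>

lemma orth_projector_diag:
  assumes "orth_projector n p Q" "i < n"
  shows "Q $$ (i, i) = of_real (\<Sum>k<n. (cmod (Q $$ (i, k)))\<^sup>2)"
    and "0 \<le> Re (Q $$ (i, i))" "Re (Q $$ (i, i)) \<le> 1"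
proof -
  have H: "Q \<in> hermitian_mats n" and Q: "Q \<in> carrier_mat n n" and QQ: "Q * Q = Q"
    using assms by (auto simp: orth_projector_def hermitian_carrier)
  have "Q $$ (i, i) = (\<Sum>k<n. Q $$ (i, k) * Q $$ (k, i))"
    using mult_mat_index[OF Q Q assms(2,2)] QQ by simp
  also have "\<dots> = (\<Sum>k<n. of_real ((cmod (Q $$ (i, k)))\<^sup>2))"
    using hermitian_index[OF H _ assms(2)]
    by (intro sum.cong refl) (simp add: complex_norm_square del: of_real_power)
  finally show eq: "Q $$ (i, i) = of_real (\<Sum>k<n. (cmod (Q $$ (i, k)))\<^sup>2)" by simp
  let ?q = "\<Sum>k<n. (cmod (Q $$ (i, k)))\<^sup>2"
  show q0: "0 \<le> Re (Q $$ (i, i))" using eq by (simp add: sum_nonneg)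
  have "(cmod (Q $$ (i, i)))\<^sup>2 \<le> ?q"
    using assms(2) by (intro member_le_sum) auto
  also have "cmod (Q $$ (i, i)) = ?q" using eq by (simp add: sum_nonneg del: of_real_sum)
  finally have "?q * ?q \<le> ?q * 1" by (simp add: power2_eq_square)
  then have "?q \<le> 1" using q0 eq mult_le_cancel_left_pos[of ?q ?q 1] by (cases "?q = 0") auto
  then show "Re (Q $$ (i, i)) \<le> 1" using eq by simp
qed

lemma orth_projector_weights:
  assumes "orth_projector n p Q" "p \<le> n"
  shows "(\<Sum>i<n. Re (Q $$ (i, i))) = p" "(\<Sum>i<n. \<Sum>k<n. (cmod (Q $$ (i, k)))\<^sup>2) = p"
proof -
  have "Re (mat_trace n Q) = p" using assms by (simp add: orth_projector_def)
  then show *: "(\<Sum>i<n. Re (Q $$ (i, i))) = p" by (simp add: mat_trace_def)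
  have "(\<Sum>i<n. \<Sum>k<n. (cmod (Q $$ (i, k)))\<^sup>2) = (\<Sum>i<n. Re (Q $$ (i, i)))"
    using orth_projector_diag(1)[OF assms(1)]
    by (intro sum.cong refl) (metis Re_complex_of_real lessThan_iff)
  then show "(\<Sum>i<n. \<Sum>k<n. (cmod (Q $$ (i, k)))\<^sup>2) = p" using * by simp
qed

lemma sum_split_at:
  fixes f :: "nat \<Rightarrow> 'a :: comm_monoid_add"
  assumes "p \<le> n"
  shows "(\<Sum>i<n. f i) = (\<Sum>i<p. f i) + (\<Sum>i\<in>{p..<n}. f i)"
  using assms by (simp add: sum.atLeastLessThan_concat[of 0 p n, symmetric] lessThan_atLeast0)

text \<open>As the weights total \<open>p\<close>, the mass missing below index \<open>p\<close>
  equals the mass \<open>?t\<close> placed at or above it. Moving that mass upwards costs at least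
  the gap per unit. The full inequality gives the coercivity used in
  \<open>projector_perturbation\<close>; bounding its left side below by 0 gives
  \<open>ky_fan\<close>.\<close>

lemma weighted_sum_gap:
  fixes mu q :: "nat \<Rightarrow> real"
  assumes p: "1 \<le> p" "p < n" and mono: "\<And>i j. i \<le> j \<Longrightarrow> j < n \<Longrightarrow> mu i \<le> mu j"
    and q: "\<And>i. i < n \<Longrightarrow> 0 \<le> q i" "\<And>i. i < n \<Longrightarrow> q i \<le> 1" and tot: "(\<Sum>i<n. q i) = p"
  shows "(mu p - mu (p - 1)) * (\<Sum>i\<in>{p..<n}. q i) \<le> (\<Sum>i<n. mu i * q i) - (\<Sum>i<p. mu i)"
proof -
  let ?t = "\<Sum>i\<in>{p..<n}. q i"
  have t: "(\<Sum>i<p. 1 - q i) = ?t"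
    using tot sum_split_at[of p n q] p by (simp add: sum_subtractf)
  have "mu p * ?t \<le> (\<Sum>i\<in>{p..<n}. mu i * q i)"
    unfolding sum_distrib_left using mono q p by (intro sum_mono mult_right_mono) auto
  moreover have "(\<Sum>i<p. mu i * (1 - q i)) \<le> mu (p - 1) * ?t"
    unfolding t[symmetric] sum_distrib_left using mono q p by (intro sum_mono mult_right_mono) auto
  ultimately show ?thesis
    using sum_split_at[of p n "\<lambda>i. mu i * q i"] p
    by (simp add: algebra_simps sum_subtractf)
qed

lemma mat_trace_diag_mult:
  assumes "Q \<in> carrier_mat n n"
  shows "mat_trace n (mat_diag n d * Q) = (\<Sum>i<n. d i * Q $$ (i, i))"
  using assms by (simp add: mat_trace_def mat_diag_mult_left)

text \<open>In the eigenbasis \<open>U\<close> the trace is a weighted sum of the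
  \<open>mu i\<close>, with the diagonal of the transformed projector as weights.\<close>

lemma ky_fan:
  fixes mu :: "nat \<Rightarrow> real"
  assumes p: "1 \<le> p" "p < n" and mono: "\<And>i j. i \<le> j \<Longrightarrow> j < n \<Longrightarrow> mu i \<le> mu j"
    and U: "U \<in> carrier_mat n n" "mat_adjoint U * U = 1\<^sub>m n"
    and A: "A \<in> carrier_mat n n" "mat_adjoint U * A * U = mat_diag n (\<lambda>i. complex_of_real (mu i))"
    and Q: "orth_projector n p Q"
  shows "(\<Sum>i<p. mu i) \<le> Re (mat_trace n (A * Q))"
proof -
  have UU: "U * mat_adjoint U = 1\<^sub>m n"
    using mat_mult_left_right_inverse[OF _ U] U(1) by simp
  have Qc: "Q \<in> carrier_mat n n" using Q by (simp add: orth_projector_def hermitian_carrier)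
  let ?Q = "mat_adjoint U * Q * U"
  have P: "orth_projector n p ?Q" by (rule orth_projector_conj[OF U(1) UU Q])
  then have Pc: "?Q \<in> carrier_mat n n" by (simp add: orth_projector_def hermitian_carrier)
  have "mat_trace n (A * Q) = mat_trace n (mat_adjoint U * (A * Q) * U)"
    using mat_trace_conj[OF U(1) UU, of "A * Q"] A Qc by simp
  also have "\<dots> = mat_trace n (mat_diag n (\<lambda>i. complex_of_real (mu i)) * ?Q)"
    using conj_mult[OF U(1) UU A(1) Qc] A(2) by simp
  also have "\<dots> = (\<Sum>i<n. complex_of_real (mu i) * ?Q $$ (i, i))" by (rule mat_trace_diag_mult[OF Pc])
  finally have *: "Re (mat_trace n (A * Q)) = (\<Sum>i<n. mu i * Re (?Q $$ (i, i)))" by simp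
  have "0 \<le> (mu p - mu (p - 1)) * (\<Sum>i\<in>{p..<n}. Re (?Q $$ (i, i)))"
    using mono p orth_projector_diag(2)[OF P] by (intro mult_nonneg_nonneg sum_nonneg) auto
  also have "\<dots> \<le> (\<Sum>i<n. mu i * Re (?Q $$ (i, i))) - (\<Sum>i<p. mu i)"
    using p orth_projector_diag[OF P] orth_projector_weights(1)[OF P]
    by (intro weighted_sum_gap mono) auto
  finally show ?thesis using * by simp
qed

subsection \<open>Second-order perturbation of the spectral projector\<close>

lemma cmod_bilinear_le:
  assumes "\<And>k. k < n \<Longrightarrow> cmod (a k) \<le> x" "\<And>k. k < n \<Longrightarrow> cmod (b k) \<le> y"
  shows "cmod (\<Sum>k<(n :: nat). a k * b k) \<le> n * (x * y)"
proof -
  have "cmod (\<Sum>k<n. a k * b k) \<le> (\<Sum>k<n. x * y)"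
    unfolding norm_mult[symmetric]
  proof (rule sum_norm_le)
    fix k assume "k \<in> {..<n}"
    then show "cmod (a k * b k) \<le> x * y"
      using assms[of k] by (auto simp: norm_mult intro!: mult_mono order_trans[OF norm_ge_zero])
  qed
  then show ?thesis by simp
qed

text \<open>Everything is expressed in the eigenbasis: \<open>Lam\<close> stands for the unperturbed
  matrix, \<open>E\<close> for its spectral projector and \<open>F\<close> for the perturbation. Of
  \<open>Q\<close> only commutation with \<open>Lam + F\<close> and a trace not above that of
  \<open>E\<close> are assumed. The two summands of the constant belong to the two kinds of entries:
  \<open>n ^ 5\<close> to the diagonal blocks, \<open>n ^ 3\<close> to the off-diagonal ones; adding
  them gives one bound for both.\<close>

lemma projector_perturbation:
  fixes n p :: nat and lam :: "nat \<Rightarrow> real" and f :: real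
  defines "Lam \<equiv> mat_diag n (\<lambda>i. complex_of_real (lam i))"
    and "E \<equiv> mat_diag n (\<lambda>i. if i < p then 1 else 0 :: complex)"
    and "g \<equiv> lam p - lam (p - 1)"
  assumes p: "1 \<le> p" "p < n" and mono: "\<And>i j. i \<le> j \<Longrightarrow> j < n \<Longrightarrow> lam i \<le> lam j"
    and gap: "0 < g"
    and F: "F \<in> carrier_mat n n" "\<And>i j. i < n \<Longrightarrow> j < n \<Longrightarrow> cmod (F $$ (i, j)) \<le> f"
    and Q: "orth_projector n p Q"
    and comm: "(Lam + F) * Q = Q * (Lam + F)"
    and minimal: "Re (mat_trace n ((Lam + F) * Q)) \<le> Re (mat_trace n ((Lam + F) * E))"
    and ij: "i < n" "j < n"
  shows "cmod (Q $$ (i, j) - E $$ (i, j) + R_mat n p lam $$ (i, j) * F $$ (i, j))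
    \<le> (4 * real n ^ 3 / g\<^sup>2 + 4 * real n ^ 5 / g\<^sup>2) * f\<^sup>2"
proof -
  have Qc: "Q \<in> carrier_mat n n" and QQ: "Q * Q = Q"
    using Q by (auto simp: orth_projector_def hermitian_carrier)
  have c: "Lam \<in> carrier_mat n n" "E \<in> carrier_mat n n" by (auto simp: Lam_def E_def)
  have f0: "0 \<le> f" using F(2)[OF ij] norm_ge_zero order_trans by blast
  define e :: "nat \<Rightarrow> complex" where "e i = (if i < p then 1 else 0)" for i
  define d where "d i j = Q $$ (i, j) - (if i = j then e i else 0)" for i j
  define t where "t = (\<Sum>i\<in>{p..<n}. Re (Q $$ (i, i)))"
  have t0: "0 \<le> t" unfolding t_def using orth_projector_diag(2)[OF Q] by (intro sum_nonneg) auto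
  have weights: "(\<Sum>i<n. Re (Q $$ (i, i))) = p" "(\<Sum>i<n. \<Sum>k<n. (cmod (Q $$ (i, k)))\<^sup>2) = p"
    using orth_projector_weights[OF Q] p by auto
  \<comment> \<open>This is the expansion of the squared Frobenius norm of \<open>Q - E\<close> as
    \<open>tr Q + tr E - 2 tr (Q E)\<close>, that is \<open>2 p - 2 (p - t)\<close>: the distance is
    measured by the mass \<open>t\<close> of \<open>Q\<close> outside the lowest \<open>p\<close>
    positions.\<close>
  have sumd: "(\<Sum>i<n. \<Sum>j<n. (cmod (d i j))\<^sup>2) = 2 * t"
  proof -
    have "(cmod (d i j))\<^sup>2 = (cmod (Q $$ (i, j)))\<^sup>2
      + (if j = i then (if i < p then 1 - 2 * Re (Q $$ (i, i)) else 0) else 0)" for i j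
      unfolding cmod_power2 by (auto simp: d_def e_def power2_eq_square algebra_simps)
    then have "(\<Sum>i<n. \<Sum>j<n. (cmod (d i j))\<^sup>2) =
        (\<Sum>i<n. \<Sum>k<n. (cmod (Q $$ (i, k)))\<^sup>2) + (\<Sum>i<n. if i < p then 1 - 2 * Re (Q $$ (i, i)) else 0)"
      by (simp add: sum.distrib)
    also have "(\<Sum>i<n. if i < p then 1 - 2 * Re (Q $$ (i, i)) else 0) = (\<Sum>i<p. 1 - 2 * Re (Q $$ (i, i)))"
      using p by (subst sum_split_at[of p n]) auto
    also have "\<dots> = p - 2 * (p - t)"
      using sum_split_at[of p n "\<lambda>i. Re (Q $$ (i, i))"] p weights
      by (simp add: t_def sum_subtractf flip: sum_distrib_left)
    finally show ?thesis using weights by simp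
  qed
  define D where "D = sqrt (2 * t)"
  have D0: "0 \<le> D" and DD: "D\<^sup>2 = 2 * t" using t0 by (auto simp: D_def)
  have dD: "cmod (d i j) \<le> D" if "i < n" "j < n" for i j
  proof -
    have "(cmod (d i j))\<^sup>2 \<le> (\<Sum>j<n. (cmod (d i j))\<^sup>2)"
      using that by (intro member_le_sum) auto
    also have "\<dots> \<le> (\<Sum>i<n. \<Sum>j<n. (cmod (d i j))\<^sup>2)"
      using that by (intro member_le_sum[of i _ "\<lambda>i. \<Sum>j<n. (cmod (d i j))\<^sup>2"]) (auto intro: sum_nonneg)
    finally have "(cmod (d i j))\<^sup>2 \<le> D\<^sup>2" unfolding sumd DD .
    then show ?thesis using D0 by (rule power2_le_imp_le)
  qed
  have trF: "mat_trace n (F * Q) - mat_trace n (F * E) = (\<Sum>i<n. \<Sum>k<n. F $$ (i, k) * d k i)"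
  proof -
    have "mat_trace n (F * Q) = (\<Sum>i<n. \<Sum>k<n. F $$ (i, k) * Q $$ (k, i))"
      unfolding mat_trace_def using F Qc by (intro sum.cong mult_mat_index) auto
    moreover have "mat_trace n (F * E) = (\<Sum>i<n. \<Sum>k<n. F $$ (i, k) * E $$ (k, i))"
      unfolding mat_trace_def using F c by (intro sum.cong mult_mat_index) auto
    moreover have "E $$ (k, i) = (if k = i then e k else 0)" if "k < n" "i < n" for k i
      using that by (simp add: E_def mat_diag_def e_def)
    ultimately show ?thesis by (simp add: d_def algebra_simps flip: sum_subtractf)
  qed
  \<comment> \<open>Minimality trades the increase of the unperturbed trace, at least
    \<open>g * t\<close>, for the decrease of the trace against \<open>F\<close>, which is linear in
    \<open>d\<close> and hence at most \<open>n\<^sup>2 * (f * D)\<close>.\<close>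
  have "g * t \<le> (\<Sum>i<n. lam i * Re (Q $$ (i, i))) - (\<Sum>i<p. lam i)"
    unfolding g_def t_def using p orth_projector_diag[OF Q] weights
    by (intro weighted_sum_gap mono) auto
  also have "(\<Sum>i<n. lam i * Re (Q $$ (i, i))) = Re (mat_trace n (Lam * Q))"
    unfolding Lam_def mat_trace_diag_mult[OF Qc] by simp
  also have "(\<Sum>i<p. lam i) = Re (mat_trace n (Lam * E))"
  proof -
    have "Re (mat_trace n (Lam * E)) = (\<Sum>i<n. if i < p then lam i else 0)"
      unfolding Lam_def mat_trace_diag_mult[OF c(2)] Re_sum
      by (intro sum.cong) (auto simp: E_def mat_diag_def)
    then show ?thesis using p by (subst (asm) sum_split_at[of p n]) auto
  qed
  also have "Re (mat_trace n (Lam * Q)) - Re (mat_trace n (Lam * E)) \<le>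
      - Re (mat_trace n (F * Q) - mat_trace n (F * E))"
    using minimal c F(1) Qc by (simp add: add_mult_distrib_mat[of _ n n] mat_trace_add)
  also have "\<dots> \<le> cmod (\<Sum>i<n. \<Sum>k<n. F $$ (i, k) * d k i)"
    unfolding trF using complex_Re_le_cmod[of "- (\<Sum>i<n. \<Sum>k<n. F $$ (i, k) * d k i)"] by simp
  also have "\<dots> \<le> (\<Sum>i<n. n * (f * D))"
    by (rule sum_norm_le) (use F dD in \<open>auto intro!: cmod_bilinear_le\<close>)
  finally have gt: "g * t \<le> n\<^sup>2 * (f * D)" by (simp add: power2_eq_square mult.assoc)
  \<comment> \<open>Since \<open>t\<close> is half of \<open>D\<^sup>2\<close>, the inequality
    \<open>gt\<close> is quadratic in \<open>D\<close> on the left and linear on the right;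
    cancelling one factor \<open>D\<close> gives a bound linear in \<open>f\<close>.\<close>
  have Df: "D \<le> 2 * n\<^sup>2 * f / g"
  proof (cases "D = 0")
    case False
    then have "D > 0" using D0 by simp
    moreover have "D * (g * D) \<le> D * (2 * n\<^sup>2 * f)"
    proof -
      have "D * (g * D) = g * D\<^sup>2" by (simp add: power2_eq_square)
      also have "\<dots> = 2 * (g * t)" unfolding DD by simp
      also have "\<dots> \<le> 2 * (n\<^sup>2 * (f * D))" using gt by simp
      finally show ?thesis by (simp add: mult_ac)
    qed
    ultimately show ?thesis using gap by (simp add: field_simps)
  qed (use f0 gap in auto)
  have sum_e: "(\<Sum>k<n. h k * (if k = j then e k else 0)) = h j * e j"
      "(\<Sum>k<n. (if j = k then e j else 0) * h k) = e j * h j" if "j < n" for h :: "nat \<Rightarrow> complex" and j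
  proof -
    have "(\<Sum>k<n. h k * (if k = j then e k else 0)) = (\<Sum>k<n. if k = j then h j * e j else 0)"
      by (intro sum.cong) auto
    then show "(\<Sum>k<n. h k * (if k = j then e k else 0)) = h j * e j" using that by simp
    have "(\<Sum>k<n. (if j = k then e j else 0) * h k) = (\<Sum>k<n. if j = k then e j * h j else 0)"
      by (intro sum.cong) auto
    then show "(\<Sum>k<n. (if j = k then e j else 0) * h k) = e j * h j" using that by simp
  qed
  have Qd: "Q $$ (i, j) = d i j + (if i = j then e i else 0)" for i j by (simp add: d_def)
  have FQ: "(\<Sum>k<n. F $$ (i, k) * Q $$ (k, j)) = (\<Sum>k<n. F $$ (i, k) * d k j) + F $$ (i, j) * e j"
    unfolding Qd distrib_left sum.distrib using sum_e ij by simp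
  have QF: "(\<Sum>k<n. Q $$ (i, k) * F $$ (k, j)) = (\<Sum>k<n. d i k * F $$ (k, j)) + e i * F $$ (i, j)"
    unfolding Qd distrib_right sum.distrib using sum_e ij by simp
  \<comment> \<open>With \<open>Q = E + d\<close> inserted in the commutation relation, the
    first-order terms stay on the left, while the right side contains only products of
    \<open>d\<close> and \<open>F\<close> and is thus quadratic in \<open>f\<close>.\<close>
  have comm_ij: "of_real (lam i - lam j) * Q $$ (i, j) + F $$ (i, j) * (e j - e i)
      = (\<Sum>k<n. d i k * F $$ (k, j)) - (\<Sum>k<n. F $$ (i, k) * d k j)"
  proof -
    have "(Lam * Q + F * Q) $$ (i, j) = (Q * Lam + Q * F) $$ (i, j)"
      using comm c F(1) Qc by (simp add: add_mult_distrib_mat[of _ n n] mult_add_distrib_mat[of _ n n])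
    moreover have "(Lam * Q + F * Q) $$ (i, j) = of_real (lam i) * Q $$ (i, j) + (\<Sum>k<n. F $$ (i, k) * Q $$ (k, j))"
      using Qc F(1) ij mult_mat_index[OF F(1) Qc ij] unfolding Lam_def mat_diag_mult_left[OF Qc] by simp
    moreover have "(Q * Lam + Q * F) $$ (i, j) = Q $$ (i, j) * of_real (lam j) + (\<Sum>k<n. Q $$ (i, k) * F $$ (k, j))"
      using Qc F(1) ij mult_mat_index[OF Qc F(1) ij] unfolding Lam_def mat_diag_mult_right[OF Qc] by simp
    ultimately show ?thesis unfolding FQ QF by (simp add: algebra_simps)
  qed
  \<comment> \<open>This is the entry of \<open>(E + d)\<^sup>2 = E + d\<close>. The factor
    \<open>e i + e j - 1\<close> is 1 or -1 inside the diagonal blocks and 0 in the off-diagonal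
    ones, so the identity gives information exactly where \<open>comm_ij\<close> may not.\<close>
  have idem_ij: "d i j * (e i + e j - 1) = - (\<Sum>k<n. d i k * d k j)"
  proof -
    have "Q $$ (i, j) = (\<Sum>k<n. Q $$ (i, k) * Q $$ (k, j))"
      using mult_mat_index[OF Qc Qc ij] QQ by simp
    also have "\<dots> = (\<Sum>k<n. d i k * d k j) + e i * d i j + d i j * e j + (if i = j then e i * e j else 0)"
      unfolding Qd distrib_left distrib_right sum.distrib using sum_e ij
      by (simp add: algebra_simps if_distrib cong: if_cong)
    finally show ?thesis unfolding Qd by (auto simp: algebra_simps e_def split: if_splits)
  qed
  have PI: "E $$ (i, j) = (if i = j then e i else 0)"
    using ij by (simp add: E_def mat_diag_def e_def)
  have b1: "cmod (\<Sum>k<n. d i k * d k j) \<le> n * (D * D)"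
    by (intro cmod_bilinear_le dD ij)
  have b2: "cmod ((\<Sum>k<n. d i k * F $$ (k, j)) - (\<Sum>k<n. F $$ (i, k) * d k j)) \<le> 2 * (n * (D * f))"
  proof -
    have "cmod (\<Sum>k<n. d i k * F $$ (k, j)) \<le> n * (D * f)"
      by (intro cmod_bilinear_le dD F(2) ij)
    moreover have "cmod (\<Sum>k<n. F $$ (i, k) * d k j) \<le> n * (f * D)"
      by (intro cmod_bilinear_le dD F(2) ij)
    ultimately show ?thesis
      using norm_triangle_ineq4[of "\<Sum>k<n. d i k * F $$ (k, j)" "\<Sum>k<n. F $$ (i, k) * d k j"]
      by (simp add: mult.commute)
  qed
  \<comment> \<open>Both final constants result from substituting \<open>Df\<close>: twice into the
    bound \<open>b1\<close>, and once into the bound \<open>b2\<close> after division by the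
    gap.\<close>
  have n1: "n * (D * D) \<le> 4 * real n ^ 5 / g\<^sup>2 * f\<^sup>2"
  proof -
    have "D * D \<le> (2 * n\<^sup>2 * f / g) * (2 * n\<^sup>2 * f / g)" using D0 Df by (intro mult_mono) auto
    then have "n * (D * D) \<le> n * ((2 * n\<^sup>2 * f / g) * (2 * n\<^sup>2 * f / g))"
      by (intro mult_left_mono) auto
    also have "\<dots> = 4 * real n ^ 5 / g\<^sup>2 * f\<^sup>2" by (simp add: power2_eq_square eval_nat_numeral)
    finally show ?thesis .
  qed
  have n2: "2 * (n * (D * f)) / g \<le> 4 * real n ^ 3 / g\<^sup>2 * f\<^sup>2"
  proof -
    have "2 * (n * (D * f)) / g \<le> 2 * (n * ((2 * n\<^sup>2 * f / g) * f)) / g"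
      using Df f0 gap by (intro divide_right_mono mult_left_mono mult_right_mono) auto
    also have "\<dots> = 4 * real n ^ 3 / g\<^sup>2 * f\<^sup>2" by (simp add: power2_eq_square eval_nat_numeral)
    finally show ?thesis .
  qed
  have pos: "0 \<le> 4 * real n ^ 5 / g\<^sup>2 * f\<^sup>2" "0 \<le> 4 * real n ^ 3 / g\<^sup>2 * f\<^sup>2" by auto
  show ?thesis
  proof (cases "(i < p) = (j < p)")
    case True
    then have "R_mat n p lam $$ (i, j) = 0" using ij by (auto simp: R_mat_def)
    then have "Q $$ (i, j) - E $$ (i, j) + R_mat n p lam $$ (i, j) * F $$ (i, j) = d i j"
      by (simp add: PI d_def)
    moreover have "cmod (d i j) = cmod (d i j * (e i + e j - 1))"
      using True by (auto simp: e_def norm_mult)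
    then have "cmod (d i j) \<le> n * (D * D)" using b1 unfolding idem_ij by simp
    ultimately have "cmod (Q $$ (i, j) - E $$ (i, j) + R_mat n p lam $$ (i, j) * F $$ (i, j))
      \<le> n * (D * D)" by simp
    then show ?thesis using n1 pos unfolding distrib_right by linarith
  next
    case False
    define s where "s = lam i - lam j"
    have gs: "g \<le> \<bar>s\<bar>"
    proof (cases "i < p")
      case True
      then have "lam p \<le> lam j" "lam i \<le> lam (p - 1)" using False p ij by (auto intro!: mono)
      then show ?thesis by (simp add: g_def s_def)
    next
      case i: False
      then have "lam p \<le> lam i" "lam j \<le> lam (p - 1)" using False p ij by (auto intro!: mono)
      then show ?thesis by (simp add: g_def s_def)
    qed
    then have s0: "s \<noteq> 0" using gap by auto
    \<comment> \<open>Written with the indicators \<open>e\<close>, both sign cases of the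
      reciprocal gap become one quotient, whose numerator is the coefficient of
      \<open>F $$ (i, j)\<close> in \<open>comm_ij\<close>.\<close>
    have R: "R_mat n p lam $$ (i, j) = (e j - e i) / of_real s"
      using False ij s0 by (auto simp: R_mat_def e_def s_def field_simps)
    have ne: "i \<noteq> j" using False by auto
    have "Q $$ (i, j) - E $$ (i, j) + R_mat n p lam $$ (i, j) * F $$ (i, j)
      = (of_real s * Q $$ (i, j) + F $$ (i, j) * (e j - e i)) / of_real s"
      unfolding R PI using ne s0 by (simp add: field_simps)
    also have "cmod \<dots> \<le> 2 * (n * (D * f)) / \<bar>s\<bar>"
      unfolding comm_ij[folded s_def] norm_divide norm_of_real
      using b2 by (intro divide_right_mono) auto
    also have "\<dots> \<le> 2 * (n * (D * f)) / g"
      using gs gap D0 f0 by (intro divide_left_mono) auto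
    finally show ?thesis using n2 pos unfolding distrib_right by linarith
  qed
qed

section \<open>Projectors onto the lowest eigenvectors of a Hermitian matrix\<close>

text \<open>The eigenvector equations say \<open>H * V = V * M\<close> with \<open>M\<close> real
  diagonal. So \<open>H * Q = V * M * mat_adjoint V\<close> is its own adjoint, which is
  commutation, and cyclicity reduces its trace to that of \<open>M\<close>. With
  \<open>ky_fan\<close>, the trace value makes \<open>Q\<close> a minimiser.\<close>

lemma lowest_eigbasis_projector:
  assumes p: "p \<le> n" and H: "H \<in> hermitian_mats n" and V: "lowest_eigbasis n p H V"
  defines "Q \<equiv> V * mat_adjoint V"
  shows "orth_projector n p Q" "H * Q = Q * H"
    "mat_trace n (H * Q) = (\<Sum>i<p. complex_of_real (sorted_eigvals H ! i))"
proof -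
  have Hc: "H \<in> carrier_mat n n" "mat_adjoint H = H" using H by (auto simp: hermitian_mats_def)
  have Vc: "V \<in> carrier_mat n p" and VV: "mat_adjoint V * V = 1\<^sub>m p"
    and ev: "\<And>i. i < p \<Longrightarrow> H *\<^sub>v col V i = complex_of_real (sorted_eigvals H ! i) \<cdot>\<^sub>v col V i"
    using V by (auto simp: lowest_eigbasis_def eigenvector_def)
  have V': "mat_adjoint V \<in> carrier_mat p n" using Vc by simp
  show "orth_projector n p Q" unfolding Q_def by (rule orth_projector_orthonormal[OF Vc VV])
  define M where "M = mat_diag p (\<lambda>i. complex_of_real (sorted_eigvals H ! i))"
  have M: "M \<in> carrier_mat p p" by (simp add: M_def)
  have HV: "H * V = V * M"
  proof (rule eq_matI)
    fix i j assume "i < dim_row (V * M)" "j < dim_col (V * M)"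
    then have ij: "i < n" "j < p" using Vc M by auto
    have "(H * V) $$ (i, j) = (H *\<^sub>v col V j) $ i" using ij Hc Vc by simp
    also have "\<dots> = (V * M) $$ (i, j)"
      unfolding ev[OF ij(2)] M_def mat_diag_mult_right[OF Vc] using ij Vc by simp
    finally show "(H * V) $$ (i, j) = (V * M) $$ (i, j)" .
  qed (use Hc Vc M in auto)
  have HQ: "H * Q = V * M * mat_adjoint V"
    unfolding Q_def using assoc_mult_mat[OF Hc(1) Vc V'] HV by simp
  have M': "mat_adjoint M = M"
    by (rule eq_matI) (auto simp: M_def mat_diag_def)
  have "Q * H = mat_adjoint (H * Q)"
  proof -
    have Qc: "Q \<in> hermitian_mats n" using \<open>orth_projector n p Q\<close> by (simp add: orth_projector_def)
    then show ?thesis using mat_adjoint_mult[OF Hc(1) hermitian_carrier[OF Qc]] Hc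
      by (simp add: hermitian_mats_def)
  qed
  also have "\<dots> = V * M * mat_adjoint V"
    unfolding HQ using mat_adjoint_mult[of "V * M" n p "mat_adjoint V" n] mat_adjoint_mult[OF Vc M]
      assoc_mult_mat[OF Vc M V'] Vc M V' M' by simp
  finally show "H * Q = Q * H" using HQ by simp
  have "mat_trace n (H * Q) = mat_trace p (mat_adjoint V * (V * M))"
    unfolding HQ by (rule mat_trace_mult_commute) (use Vc M V' in auto)
  also have "mat_adjoint V * (V * M) = M"
    using assoc_mult_mat[OF V' Vc M] left_mult_one_mat[OF M] unfolding VV by (rule trans[OF sym])
  finally show "mat_trace n (H * Q) = (\<Sum>i<p. complex_of_real (sorted_eigvals H ! i))"
    by (simp add: mat_trace_def M_def mat_diag_def)
qed

text \<open>The choice operator in \<open>scf_map\<close> yields a genuine eigenbasis only because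
  one exists: the first \<open>p\<close> columns of a unitary matrix that diagonalises
  \<open>H\<close> in sorted order.\<close>

lemma lowest_eigbasis_exists:
  assumes p: "p \<le> n" and H: "H \<in> hermitian_mats n"
  shows "\<exists>V. lowest_eigbasis n p H V"
proof -
  have Hc: "H \<in> carrier_mat n n" using H by (rule hermitian_carrier)
  obtain U where U: "U \<in> carrier_mat n n" "mat_adjoint U * U = 1\<^sub>m n"
    "mat_adjoint U * H * U = mat_diag n (\<lambda>i. complex_of_real (sorted_eigvals H ! i))"
    using hermitian_sorted_eigbasis(1)[OF H] by blast
  have U': "mat_adjoint U \<in> carrier_mat n n" using U by simp
  have UU: "U * mat_adjoint U = 1\<^sub>m n"
    using mat_mult_left_right_inverse[OF U' U(1,2)] .
  let ?D = "mat_diag n (\<lambda>i. complex_of_real (sorted_eigvals H ! i))"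
  have "U * ?D = U * (mat_adjoint U * (H * U))"
    using U(3) assoc_mult_mat[OF U' Hc U(1)] by simp
  also have "\<dots> = H * U"
    using assoc_mult_mat[OF U(1) U', of "H * U" n] Hc U left_mult_one_mat[of "H * U" n n] UU by simp
  finally have HU: "H * U = U * ?D" ..
  define V where "V = mat n p (\<lambda>(i, j). U $$ (i, j))"
  have col: "col V j = col U j" if "j < p" for j
    using that U p by (intro eq_vecI) (auto simp: V_def)
  have Vc: "V \<in> carrier_mat n p" by (simp add: V_def)
  have "mat_adjoint V * V = 1\<^sub>m p"
  proof (rule eq_matI)
    fix i j assume "i < dim_row (1\<^sub>m p :: complex mat)" "j < dim_col (1\<^sub>m p :: complex mat)"
    then have ij: "i < p" "j < p" by auto
    have "(mat_adjoint V * V) $$ (i, j) = (\<Sum>k<n. mat_adjoint V $$ (i, k) * V $$ (k, j))"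
      using Vc ij by (intro mult_mat_index) auto
    also have "\<dots> = (\<Sum>k<n. mat_adjoint U $$ (i, k) * U $$ (k, j))"
      using Vc ij U p by (intro sum.cong) (auto simp: V_def)
    also have "\<dots> = (mat_adjoint U * U) $$ (i, j)"
      using ij p by (intro mult_mat_index[OF U' U(1), symmetric]) auto
    finally show "(mat_adjoint V * V) $$ (i, j) = 1\<^sub>m p $$ (i, j)" using U(2) ij p by simp
  qed (auto simp: V_def)
  moreover have "eigenvector H (col V i) (complex_of_real (sorted_eigvals H ! i))" if "i < p" for i
  proof -
    \<comment> \<open>An eigenvector must be nonzero; a zero column of \<open>U\<close> would make
      the corresponding column of \<open>mat_adjoint U * U\<close> vanish instead of being a unit
      vector.\<close>
    have "col U i \<noteq> 0\<^sub>v n"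
    proof
      assume "col U i = 0\<^sub>v n"
      then have "col (mat_adjoint U * U) i = mat_adjoint U *\<^sub>v 0\<^sub>v n"
        using col_mult2[OF U' U(1)] that p by simp
      also have "\<dots> = 0\<^sub>v n" using U' by (intro eq_vecI) auto
      finally have "unit_vec n i $ i = (0 :: complex)" using U(2) that p by simp
      then show False using that p by simp
    qed
    moreover have "H *\<^sub>v col U i = col (H * U) i" using col_mult2[OF Hc U(1)] that p by simp
    then have "H *\<^sub>v col U i = complex_of_real (sorted_eigvals H ! i) \<cdot>\<^sub>v col U i"
      unfolding HU mat_diag_mult_right[OF U(1)] using that p U(1) by (auto intro!: eq_vecI simp: mult.commute)
    ultimately show ?thesis using Hc U(1) col[OF that] by (auto simp: eigenvector_def)
  qed
  ultimately show ?thesis using Vc unfolding lowest_eigbasis_def by blast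
qed

subsection \<open>Vectorization and half-vectorization\<close>

lemma concat_uniform:
  assumes "\<And>xs. xs \<in> set xss \<Longrightarrow> length xs = n"
  shows "length (concat xss) = length xss * n"
    and "k < length xss * n \<Longrightarrow> concat xss ! k = xss ! (k div n) ! (k mod n)"
proof -
  show "length (concat xss) = length xss * n"
    using assms by (induction xss) auto
  show "concat xss ! k = xss ! (k div n) ! (k mod n)" if "k < length xss * n"
    using assms that
  proof (induction xss arbitrary: k)
    case (Cons xs xss)
    have xs: "length xs = n" using Cons.prems(1) by simp
    show ?case
    proof (cases "k < n")
      case False
      moreover have "n > 0" using Cons.prems(2) by (cases n) auto
      ultimately have "k div n = Suc ((k - n) div n)" "k mod n = (k - n) mod n"
        by (simp_all add: le_div_geq le_mod_geq)
      then show ?thesis using False xs Cons by (simp add: nth_append)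
    qed (use xs in \<open>simp add: nth_append\<close>)
  qed simp
qed

lemma vec_op_eq:
  assumes "W \<in> carrier_mat n m"
  shows "vec_op W = vec (m * n) (\<lambda>k. W $$ (k mod n, k div n))"
proof -
  let ?xss = "map list_of_vec (cols W)"
  have len: "length xs = n" if "xs \<in> set ?xss" for xs
    using that assms by (auto simp: cols_def)
  have l: "length ?xss = m" using assms by simp
  have "vec_of_list (concat ?xss) $ k = W $$ (k mod n, k div n)" if k: "k < m * n" for k
  proof -
    have "n > 0" using k by (cases n) auto
    then have "k mod n < n" "k div n < m" using k by (auto simp: less_mult_imp_div_less)
    then show ?thesis
      using concat_uniform(2)[of ?xss n k] len k l assms
      by (simp add: vec_of_list_index list_of_vec_index cols_nth)
  qed
  then show ?thesis
    using concat_uniform(1)[of ?xss n] len l by (intro eq_vecI) (auto simp: vec_op_def)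
qed

lemma sum_div_mod:
  fixes h :: "nat \<Rightarrow> nat \<Rightarrow> 'a :: comm_monoid_add"
  shows "(\<Sum>k<b * d. h (k div d) (k mod d)) = (\<Sum>l<b. \<Sum>m<d. h l m)"
proof -
  have "(\<Sum>k<b * d. h (k div d) (k mod d)) = (\<Sum>l<b. \<Sum>k\<in>{l * d..<l * d + d}. h (k div d) (k mod d))"
    by (rule sum.nat_group[symmetric])
  also have "\<dots> = (\<Sum>l<b. \<Sum>m<d. h l m)"
  proof (rule sum.cong[OF refl])
    fix l
    have "(\<Sum>k\<in>{l * d..<l * d + d}. h (k div d) (k mod d)) =
        (\<Sum>m\<in>{0..<d}. h ((m + l * d) div d) ((m + l * d) mod d))"
      using sum.shift_bounds_nat_ivl[of "\<lambda>k. h (k div d) (k mod d)" 0 "l * d" d] by (simp add: add.commute)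
    also have "\<dots> = (\<Sum>m<d. h l m)"
      by (intro sum.cong) auto
    finally show "(\<Sum>k\<in>{l * d..<l * d + d}. h (k div d) (k mod d)) = (\<Sum>m<d. h l m)" .
  qed
  finally show ?thesis .
qed

lemma kron_carrier [simp]:
  "A \<in> carrier_mat a b \<Longrightarrow> B \<in> carrier_mat c d \<Longrightarrow> kron A B \<in> carrier_mat (a * c) (b * d)"
  by (simp add: kron_def)

lemma mult_mat_vec_index:
  assumes "A \<in> carrier_mat a b" "v \<in> carrier_vec b" "i < a"
  shows "(A *\<^sub>v v) $ i = (\<Sum>k<b. A $$ (i, k) * v $ k)"
  using assms by (simp add: scalar_prod_def lessThan_atLeast0)

text \<open>The classical rule linking Kronecker products with two-sided multiplication. Position
  \<open>k\<close> of the stacked vector is column \<open>k div d\<close>, row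
  \<open>k mod d\<close>, which are precisely the outer and inner column indices of
  \<open>kron A B\<close>.\<close>

lemma kron_mult_vec_op:
  assumes A: "A \<in> carrier_mat a b" and B: "B \<in> carrier_mat c d" and W: "W \<in> carrier_mat d b"
  shows "kron A B *\<^sub>v vec_op W = vec_op (B * W * transpose_mat A)"
proof -
  have BWA: "B * W * transpose_mat A \<in> carrier_mat c a" using A B W by auto
  show ?thesis unfolding vec_op_eq[OF BWA] vec_op_eq[OF W]
  proof (rule eq_vecI)
    fix i assume "i < dim_vec (vec (a * c) (\<lambda>k. (B * W * transpose_mat A) $$ (k mod c, k div c)))"
    then have i: "i < a * c" by simp
    then have "c > 0" by (cases c) auto
    then have ic: "i mod c < c" "i div c < a" using i by (auto simp: less_mult_imp_div_less)
    have BW: "B * W \<in> carrier_mat c b" and AT: "transpose_mat A \<in> carrier_mat b a" using A B W by auto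
    have "(kron A B *\<^sub>v vec (b * d) (\<lambda>k. W $$ (k mod d, k div d))) $ i =
       (\<Sum>k<b * d. A $$ (i div c, k div d) * B $$ (i mod c, k mod d) * W $$ (k mod d, k div d))"
      using A B i by (subst mult_mat_vec_index[OF kron_carrier[OF A B]]) (auto simp: kron_def)
    also have "\<dots> = (\<Sum>l<b. \<Sum>m<d. A $$ (i div c, l) * B $$ (i mod c, m) * W $$ (m, l))"
      by (rule sum_div_mod)
    also have "\<dots> = (\<Sum>l<b. (B * W) $$ (i mod c, l) * transpose_mat A $$ (l, i div c))"
      using mult_mat_index[OF B W] ic A
      by (intro sum.cong refl) (simp add: sum_distrib_left mult_ac del: index_mult_mat(1))
    also have "\<dots> = (B * W * transpose_mat A) $$ (i mod c, i div c)"
      using ic by (intro mult_mat_index[OF BW AT, symmetric]) auto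
    finally show "(kron A B *\<^sub>v vec (b * d) (\<lambda>k. W $$ (k mod d, k div d))) $ i =
       vec (a * c) (\<lambda>k. (B * W * transpose_mat A) $$ (k mod c, k div c)) $ i" using i by simp
  qed (use A B in \<open>auto simp: kron_def\<close>)
qed

text \<open>Multiplication by the diagonal matrix is a Hadamard product with \<open>R_mat\<close>;
  in this form the reciprocal gaps of \<open>projector_perturbation\<close> are recognised in
  \<open>response_mat\<close>.\<close>

lemma D_mat_mult_vec_op:
  assumes W: "W \<in> carrier_mat n n"
  shows "D_mat n p lam *\<^sub>v vec_op W = vec_op (mat n n (\<lambda>ij. R_mat n p lam $$ ij * W $$ ij))"
proof -
  have R: "R_mat n p lam \<in> carrier_mat n n" by (simp add: R_mat_def)
  have RW: "mat n n (\<lambda>ij. R_mat n p lam $$ ij * W $$ ij) \<in> carrier_mat n n" by simp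
  show ?thesis
  proof (rule eq_vecI)
    fix k assume "k < dim_vec (vec_op (mat n n (\<lambda>ij. R_mat n p lam $$ ij * W $$ ij)))"
    then have k: "k < n * n" unfolding vec_op_eq[OF RW] by simp
    then have "n > 0" by (cases n) auto
    then have kn: "k mod n < n" "k div n < n" using k by (auto simp: less_mult_imp_div_less)
    have "(D_mat n p lam *\<^sub>v vec_op W) $ k = (\<Sum>l<n * n. D_mat n p lam $$ (k, l) * vec_op W $ l)"
      using k vec_op_eq[OF W] by (intro mult_mat_vec_index) (auto simp: D_mat_def)
    also have "\<dots> = (\<Sum>l<n * n. (if l = k then vec_op (R_mat n p lam) $ k * vec_op W $ k else 0))"
      using k by (intro sum.cong) (auto simp: D_mat_def mat_diag_def)
    also have "\<dots> = vec_op (R_mat n p lam) $ k * vec_op W $ k" using k by simp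
    finally show "(D_mat n p lam *\<^sub>v vec_op W) $ k = vec_op (mat n n (\<lambda>ij. R_mat n p lam $$ ij * W $$ ij)) $ k"
      using k kn unfolding vec_op_eq[OF R] vec_op_eq[OF W] vec_op_eq[OF RW] by simp
  qed (use vec_op_eq[OF RW] in \<open>simp add: D_mat_def mat_diag_def\<close>)
qed

section \<open>Half-vectorization through the list of lower triangular positions\<close>

text \<open>Keeping the positions as a list in the order of \<open>vech\<close> avoids an explicit
  formula for the place of a pair \<open>(i, j)\<close>: membership and distinctness suffice, and
  the length stands for \<open>n * (n + 1) div 2\<close>.\<close>

definition tri_indices :: "nat \<Rightarrow> (nat \<times> nat) list" where
  "tri_indices n = concat (map (\<lambda>j. map (\<lambda>i. (i, j)) [j..<n]) [0..<n])"

lemma set_tri_indices: "set (tri_indices n) = {(i, j). j \<le> i \<and> i < n}"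
  by (force simp: tri_indices_def)

lemma distinct_tri_indices: "distinct (tri_indices n)"
  unfolding tri_indices_def
proof (rule distinct_concat)
  have "x = y" if "x < n" and eq: "map (\<lambda>i. (i, x)) [x..<n] = map (\<lambda>i. (i, y)) [y..<n]" for x y
  proof -
    have "(x, x) \<in> set (map (\<lambda>i. (i, y)) [y..<n])" unfolding eq[symmetric] using \<open>x < n\<close> by simp
    then show ?thesis by auto
  qed
  then show "distinct (map (\<lambda>j. map (\<lambda>i. (i, j)) [j..<n]) [0..<n])"
    by (auto simp: distinct_map inj_on_def)
qed (auto simp: distinct_map inj_on_def)

lemma length_tri_indices: "length (tri_indices n) = n * (n + 1) div 2"
proof -
  have "length (tri_indices n) = sum_list (map (\<lambda>j. n - j) [0..<n])"
    by (simp add: tri_indices_def length_concat o_def)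
  also have "\<dots> = n * (n + 1) div 2"
  proof (induction n)
    case (Suc n)
    \<comment> \<open>Peeling off the first column, of length \<open>Suc n\<close>, leaves columns
      of the same lengths as for size \<open>n\<close>.\<close>
    have "[0..<Suc n] = 0 # map Suc [0..<n]" by (simp add: upt_conv_Cons map_Suc_upt)
    then show ?case using Suc by (simp add: o_def del: upt_Suc)
  qed simp
  finally show ?thesis .
qed

lemma vech_eq:
  assumes "W \<in> carrier_mat n n"
  shows "vech W = vec_of_list (map (($$) W) (tri_indices n))"
  using assms by (simp add: vech_def tri_indices_def map_concat o_def)

lemma dim_vech: "W \<in> carrier_mat n n \<Longrightarrow> dim_vec (vech W) = length (tri_indices n)"
  by (simp add: vech_eq)

lemma vech_index:
  "W \<in> carrier_mat n n \<Longrightarrow> k < length (tri_indices n) \<Longrightarrow> vech W $ k = W $$ (tri_indices n ! k)"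
  by (simp add: vech_eq vec_of_list_index)

lemma diag_block_mat_mult_concat:
  assumes "\<And>j. j \<in> set js \<Longrightarrow> dim_col (f j) = dim_vec (v j)"
  shows "diag_block_mat (map f js) *\<^sub>v vec_of_list (concat (map (\<lambda>j. list_of_vec (v j)) js))
    = vec_of_list (concat (map (\<lambda>j. list_of_vec (f j *\<^sub>v (v j :: 'a :: comm_semiring_1 vec))) js))"
  using assms
proof (induction js)
  case (Cons j js)
  let ?D = "diag_block_mat (map f js)" and ?v = "vec_of_list (concat (map (\<lambda>j. list_of_vec (v j)) js))"
  have dv: "dim_col ?D = dim_vec ?v"
    using Cons.prems by (simp add: dim_diag_block_mat length_concat o_def cong: map_cong)
  have zero: "0\<^sub>m a (dim_vec x) *\<^sub>v x = 0\<^sub>v a" for a and x :: "'a vec"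
    by (rule eq_vecI) (auto simp: scalar_prod_def intro!: sum.neutral)
  have app: "vec_of_list (list_of_vec x @ ys) = x @\<^sub>v vec_of_list ys" for x :: "'a vec" and ys
    by (rule eq_vecI) (auto simp: vec_of_list_index nth_append list_of_vec_index)
  have "diag_block_mat (map f (j # js)) *\<^sub>v vec_of_list (concat (map (\<lambda>j. list_of_vec (v j)) (j # js)))
    = four_block_mat (f j) (0\<^sub>m (dim_row (f j)) (dim_col ?D)) (0\<^sub>m (dim_row ?D) (dim_col (f j))) ?D *\<^sub>v (v j @\<^sub>v ?v)"
    by (simp add: Let_def app)
  also have "\<dots> = (f j *\<^sub>v v j + 0\<^sub>m (dim_row (f j)) (dim_col ?D) *\<^sub>v ?v) @\<^sub>v
      (0\<^sub>m (dim_row ?D) (dim_col (f j)) *\<^sub>v v j + ?D *\<^sub>v ?v)"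
    by (rule four_block_mat_mult_vec) (use Cons.prems dv in \<open>auto intro: carrier_vecI simp: dv\<close>)
  also have "f j *\<^sub>v v j + 0\<^sub>m (dim_row (f j)) (dim_col ?D) *\<^sub>v ?v = f j *\<^sub>v v j"
    unfolding dv zero by (intro eq_vecI) auto
  also have "0\<^sub>m (dim_row ?D) (dim_col (f j)) *\<^sub>v v j + ?D *\<^sub>v ?v = ?D *\<^sub>v ?v"
    using Cons.prems zero[of _ "v j"] by (intro eq_vecI) auto
  finally show ?case using Cons by (simp add: app)
qed (auto intro!: eq_vecI)

lemma T_mat_carrier: "T_mat n \<in> carrier_mat (length (tri_indices n)) (n * n)"
  by (auto simp: T_mat_def dim_diag_block_mat tri_indices_def length_concat o_def sum_list_triv)

text \<open>Block \<open>k\<close> of \<open>T_mat\<close> drops the first \<open>k\<close> entries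
  of column \<open>k\<close>, that is, the entries strictly above the diagonal.\<close>

lemma T_mat_mult_vec_op:
  assumes W: "W \<in> carrier_mat n n"
  shows "T_mat n *\<^sub>v vec_op W = vech W"
proof -
  let ?B = "\<lambda>k. mat (n - k) n (\<lambda>(i, j). if j = k + i then 1 else 0 :: complex)"
  have "T_mat n *\<^sub>v vec_op W
    = diag_block_mat (map ?B [0..<n]) *\<^sub>v vec_of_list (concat (map (\<lambda>j. list_of_vec (col W j)) [0..<n]))"
    using W by (simp add: T_mat_def vec_op_def cols_def o_def)
  also have "\<dots> = vec_of_list (concat (map (\<lambda>j. list_of_vec (?B j *\<^sub>v col W j)) [0..<n]))"
    by (rule diag_block_mat_mult_concat) (use W in auto)
  also have "map (\<lambda>j. list_of_vec (?B j *\<^sub>v col W j)) [0..<n] = map (\<lambda>j. map (\<lambda>i. W $$ (i, j)) [j..<n]) [0..<n]"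
  proof (rule map_cong[OF refl])
    fix k assume "k \<in> set [0..<n]"
    then have k: "k < n" by simp
    show "list_of_vec (?B k *\<^sub>v col W k) = map (\<lambda>i. W $$ (i, k)) [k..<n]"
    proof (rule nth_equalityI)
      fix i assume "i < length (list_of_vec (?B k *\<^sub>v col W k))"
      then have i: "i < n - k" by simp
      have "(?B k *\<^sub>v col W k) $ i = (\<Sum>j<n. ?B k $$ (i, j) * col W k $ j)"
        using i k W by (intro mult_mat_vec_index[of _ "n - k"]) (auto intro!: carrier_vecI)
      also have "\<dots> = (\<Sum>j<n. if j = k + i then W $$ (k + i, k) else 0)"
        using i k W by (intro sum.cong) auto
      finally have "(?B k *\<^sub>v col W k) $ i = \<dots>" .
      then show "list_of_vec (?B k *\<^sub>v col W k) ! i = map (\<lambda>i. W $$ (i, k)) [k..<n] ! i"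
        using i k by (simp add: list_of_vec_index)
    qed simp
  qed
  finally show ?thesis using W by (simp add: vech_def)
qed

lemma tri_indices_nth:
  assumes "k < length (tri_indices n)"
  obtains i j where "tri_indices n ! k = (i, j)" "j \<le> i" "i < n"
  using nth_mem[OF assms] set_tri_indices[of n] by auto

lemma vech_uminus:
  assumes "W \<in> carrier_mat n n"
  shows "vech (- W) = - vech W"
proof (rule eq_vecI)
  fix k assume "k < dim_vec (- vech W)"
  then have k: "k < length (tri_indices n)" using assms by (simp add: dim_vech)
  obtain i j where "tri_indices n ! k = (i, j)" "j \<le> i" "i < n" by (rule tri_indices_nth[OF k])
  then show "vech (- W) $ k = (- vech W) $ k"
    using assms k by (simp add: vech_index dim_vech)
qed (use assms in \<open>simp add: dim_vech\<close>)

lemma vech_minus: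
  assumes "U \<in> carrier_mat n n" "W \<in> carrier_mat n n"
  shows "vech (U - W) = vech U - vech W"
proof (rule eq_vecI)
  fix k assume "k < dim_vec (vech U - vech W)"
  then have k: "k < length (tri_indices n)" using assms by (simp add: dim_vech)
  obtain i j where "tri_indices n ! k = (i, j)" "j \<le> i" "i < n" by (rule tri_indices_nth[OF k])
  then show "vech (U - W) $ k = (vech U - vech W) $ k"
    using assms k minus_carrier_mat[OF assms(2), of U] by (simp add: vech_index dim_vech)
qed (use assms minus_carrier_mat[OF assms(2), of U] in \<open>simp add: dim_vech\<close>)

text \<open>The right Kronecker factor moves \<open>E\<close> into the eigenbasis,
  \<open>D_mat\<close> weights the entries there, and the left factor moves the result back, because
  the transpose of the entrywise conjugate of \<open>X\<close> is its adjoint.\<close>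

lemma response_mat_mult_vec_op:
  assumes X: "X \<in> carrier_mat n n" and E: "E \<in> carrier_mat n n"
  shows "response_mat n p X lam *\<^sub>v vec_op E =
    - vech (X * mat n n (\<lambda>ij. R_mat n p lam $$ ij * (mat_adjoint X * E * X) $$ ij) * mat_adjoint X)"
proof -
  have cX: "map_mat cnj X \<in> carrier_mat n n" "transpose_mat X \<in> carrier_mat n n" "mat_adjoint X \<in> carrier_mat n n"
    using X by auto
  let ?T = "T_mat n" and ?K = "kron (map_mat cnj X) X" and ?K' = "kron (transpose_mat X) (mat_adjoint X)"
  let ?D = "D_mat n p lam" and ?m = "length (tri_indices n)"
  let ?F = "mat_adjoint X * E * X"
  let ?S = "mat n n (\<lambda>ij. R_mat n p lam $$ ij * ?F $$ ij)"
  have T: "?T \<in> carrier_mat ?m (n * n)" by (rule T_mat_carrier)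
  have c: "?K \<in> carrier_mat (n * n) (n * n)" "?K' \<in> carrier_mat (n * n) (n * n)" "?D \<in> carrier_mat (n * n) (n * n)"
    using X cX by (auto simp: D_mat_def)
  have v: "vec_op E \<in> carrier_vec (n * n)" by (simp add: vec_op_eq[OF E])
  have F: "?F \<in> carrier_mat n n" "?S \<in> carrier_mat n n"
    using X E by (auto intro!: mult_carrier_mat[of _ n n])
  have XSX: "X * ?S * mat_adjoint X \<in> carrier_mat n n"
    by (intro mult_carrier_mat[of _ n n] X F(2) cX(3))
  have cnjT: "transpose_mat (map_mat cnj X) = mat_adjoint X"
    by (rule eq_matI) (use X in auto)
  have "response_mat n p X lam *\<^sub>v vec_op E = - ?T *\<^sub>v (?K *\<^sub>v (?D *\<^sub>v (?K' *\<^sub>v vec_op E)))"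
    unfolding response_mat_def using T c v
    by (simp add: assoc_mult_mat_vec[of _ ?m "n * n" _ "n * n"])
  also have "?K' *\<^sub>v vec_op E = vec_op ?F"
    using kron_mult_vec_op[OF cX(2,3) E] by simp
  also have "?D *\<^sub>v vec_op ?F = vec_op ?S" by (rule D_mat_mult_vec_op[OF F(1)])
  also have "?K *\<^sub>v vec_op ?S = vec_op (X * ?S * mat_adjoint X)"
    using kron_mult_vec_op[OF cX(1) X F(2)] cnjT by simp
  also have "- ?T *\<^sub>v vec_op (X * ?S * mat_adjoint X) = - (?T *\<^sub>v vec_op (X * ?S * mat_adjoint X))"
    using T vec_op_eq[OF XSX] by (intro uminus_mult_mat_vec) auto
  also have "?T *\<^sub>v vec_op (X * ?S * mat_adjoint X) = vech (X * ?S * mat_adjoint X)"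
    by (rule T_mat_mult_vec_op[OF XSX])
  finally show ?thesis .
qed


lemma vech_cong_hermitian:
  assumes U: "U \<in> hermitian_mats n" and W: "W \<in> hermitian_mats n" and eq: "vech U = vech W"
  shows "U = W"
proof -
  have c: "U \<in> carrier_mat n n" "W \<in> carrier_mat n n" using U W by (auto simp: hermitian_mats_def)
  have low: "U $$ (i, j) = W $$ (i, j)" if "j \<le> i" "i < n" for i j
  proof -
    have "(i, j) \<in> set (tri_indices n)" using that by (simp add: set_tri_indices)
    then obtain k where "k < length (tri_indices n)" "tri_indices n ! k = (i, j)"
      by (auto simp: in_set_conv_nth)
    then show ?thesis using vech_index[OF c(1), of k] vech_index[OF c(2), of k] eq by simp
  qed
  show ?thesis
  proof (rule eq_matI)
    fix i j assume "i < dim_row W" "j < dim_col W"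
    then have ij: "i < n" "j < n" using c by auto
    show "U $$ (i, j) = W $$ (i, j)"
    proof (cases "j \<le> i")
      case False
      then show ?thesis
        using low[where i = j and j = i] hermitian_index[OF U ij] hermitian_index[OF W ij] ij by simp
    qed (use low ij in auto)
  qed (use c in auto)
qed

text \<open>The explicit form of \<open>vech_inv\<close> at a unit vector. Passing from
  \<open>(i, j)\<close> to \<open>(max i j, min i j)\<close> reflects a position into the lower
  triangle, so the matrix is real symmetric.\<close>

definition tri_unit :: "nat \<Rightarrow> nat \<Rightarrow> complex mat" where
  "tri_unit n k = mat n n (\<lambda>(i, j). if (max i j, min i j) = tri_indices n ! k then 1 else 0)"

lemma vech_inv_unit_vec:
  assumes k: "k < length (tri_indices n)"
  shows "vech_inv n (unit_vec (length (tri_indices n)) k) = tri_unit n k"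
proof -
  let ?e = "unit_vec (length (tri_indices n)) k :: complex vec"
  have E: "tri_unit n k \<in> hermitian_mats n"
    by (rule hermitianI) (auto simp: tri_unit_def max.commute min.commute)
  then have Ec: "tri_unit n k \<in> carrier_mat n n" by (simp add: hermitian_mats_def)
  have "vech (tri_unit n k) = ?e"
  proof (rule eq_vecI)
    fix l assume "l < dim_vec ?e"
    then have l: "l < length (tri_indices n)" by simp
    obtain i j where ij: "tri_indices n ! l = (i, j)" "j \<le> i" "i < n" by (rule tri_indices_nth[OF l])
    have "(tri_indices n ! l = tri_indices n ! k) = (l = k)"
      using nth_eq_iff_index_eq[OF distinct_tri_indices l k] .
    then show "vech (tri_unit n k) $ l = ?e $ l"
      using vech_index[OF Ec l] ij l k by (simp add: tri_unit_def max_absorb1 min_absorb2 unit_vec_def)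
  qed (use dim_vech[OF Ec] in simp)
  moreover have "inj_on vech (hermitian_mats n)"
    by (rule inj_onI) (rule vech_cong_hermitian)
  ultimately show ?thesis using E inv_into_f_f[of vech "hermitian_mats n" "tri_unit n k"] by (simp add: vech_inv_def)
qed

section \<open>Linear maps on matrices in coordinates\<close>

text \<open>\<open>G i j a b\<close> is the entry \<open>(a, b)\<close> of the image of the matrix
  unit at \<open>(i, j)\<close>. These coordinates serve twice: for the action of
  \<open>L_prime\<close> and for the boundedness of \<open>L\<close>.\<close>

lemma complex_linear_on_mats_coeffs:
  assumes L: "complex_linear_on_mats n L"
  obtains G where "\<And>U a b. U \<in> carrier_mat n n \<Longrightarrow> a < n \<Longrightarrow> b < n \<Longrightarrow>
    L U $$ (a, b) = (\<Sum>i<n. \<Sum>j<n. U $$ (i, j) * G i j a b)"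
proof -
  have Lc: "L U \<in> carrier_mat n n" if "U \<in> carrier_mat n n" for U
    using L that by (auto simp: complex_linear_on_mats_def)
  have Ladd: "L (U + W) = L U + L W" if "U \<in> carrier_mat n n" "W \<in> carrier_mat n n" for U W
    using L that by (auto simp: complex_linear_on_mats_def)
  have Lsmult: "L (c \<cdot>\<^sub>m U) = c \<cdot>\<^sub>m L U" if "U \<in> carrier_mat n n" for U c
    using L that by (auto simp: complex_linear_on_mats_def)
  define e where "e s = mat n n (\<lambda>r. if r = s then 1 else 0 :: complex)" for s
  have ec: "e s \<in> carrier_mat n n" for s by (simp add: e_def)
  \<comment> \<open>Additivity is available for two summands at a time, so \<open>U\<close> is
    assembled by adding one position of its support after another.\<close>
  have restr: "L (mat n n (\<lambda>r. if r \<in> S then U $$ r else 0)) $$ (a, b) = (\<Sum>s\<in>S. U $$ s * L (e s) $$ (a, b))"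
    if "finite S" and ab: "a < n" "b < n" for S U a b
    using \<open>finite S\<close>
  proof (induction S rule: finite_induct)
    case empty
    \<comment> \<open>That \<open>L\<close> maps zero to zero is obtained from homogeneity, with the
      zero matrix written as 0 times a matrix unit.\<close>
    have "mat n n (\<lambda>r. if r \<in> {} then U $$ r else 0) = 0 \<cdot>\<^sub>m e (0, 0)"
      by (rule eq_matI) (auto simp: e_def)
    then show ?case using Lsmult[OF ec[of "(0, 0)"], of 0] Lc[OF ec[of "(0, 0)"]] ab by simp
  next
    case (insert s S)
    let ?R = "mat n n (\<lambda>r. if r \<in> S then U $$ r else 0)"
    have R: "?R \<in> carrier_mat n n" by simp
    have "mat n n (\<lambda>r. if r \<in> insert s S then U $$ r else 0) = U $$ s \<cdot>\<^sub>m e s + ?R"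
      by (rule eq_matI) (use insert.hyps in \<open>auto simp: e_def\<close>)
    then have "L (mat n n (\<lambda>r. if r \<in> insert s S then U $$ r else 0)) = U $$ s \<cdot>\<^sub>m L (e s) + L ?R"
      using Ladd[OF smult_carrier_mat[OF ec] R] Lsmult[OF ec] by simp
    then show ?case using insert Lc[OF ec[of s]] Lc[OF R] ab by simp
  qed
  show ?thesis
  proof (rule that[of "\<lambda>i j a b. L (e (i, j)) $$ (a, b)"])
    fix U :: "complex mat" and a b assume U: "U \<in> carrier_mat n n" and ab: "a < n" "b < n"
    have "mat n n (\<lambda>r. if r \<in> {..<n} \<times> {..<n} then U $$ r else 0) = U"
      by (rule eq_matI) (use U in auto)
    then have "L U $$ (a, b) = (\<Sum>s\<in>{..<n} \<times> {..<n}. U $$ s * L (e s) $$ (a, b))"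
      using restr[of "{..<n} \<times> {..<n}" a b U] ab by simp
    also have "\<dots> = (\<Sum>i<n. \<Sum>j<n. U $$ (i, j) * L (e (i, j)) $$ (a, b))"
      by (simp add: sum.cartesian_product)
    finally show "L U $$ (a, b) = \<dots>" .
  qed
qed

text \<open>The columns of \<open>L_prime\<close> are the images of the \<open>tri_unit\<close>
  matrices, so the product is the image of their combination with coefficients
  \<open>vech M\<close>. That combination copies the lower triangle to the upper one without
  conjugation, and therefore returns \<open>M\<close> exactly when \<open>M\<close> is
  symmetric.\<close>

lemma L_prime_mult_vech:
  assumes L: "complex_linear_on_mats n L" and M: "M \<in> carrier_mat n n"
    and sym: "\<And>i j. i < n \<Longrightarrow> j < n \<Longrightarrow> M $$ (i, j) = M $$ (j, i)"
  shows "L_prime n L *\<^sub>v vech M = vec_op (L M)"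
proof -
  obtain G where G: "\<And>U a b. U \<in> carrier_mat n n \<Longrightarrow> a < n \<Longrightarrow> b < n \<Longrightarrow>
    L U $$ (a, b) = (\<Sum>i<n. \<Sum>j<n. U $$ (i, j) * G i j a b)"
    using complex_linear_on_mats_coeffs[OF L] by blast
  have Lc: "L U \<in> carrier_mat n n" if "U \<in> carrier_mat n n" for U
    using L that by (auto simp: complex_linear_on_mats_def)
  let ?m = "length (tri_indices n)"
  have tc: "tri_unit n k \<in> carrier_mat n n" for k by (simp add: tri_unit_def)
  have L': "L_prime n L = mat_of_cols (n * n) (map (\<lambda>k. vec_op (L (tri_unit n k))) [0..<?m])"
    unfolding L_prime_def length_tri_indices[symmetric]
    by (intro arg_cong[of _ _ "mat_of_cols (n * n)"] map_cong) (auto simp: vech_inv_unit_vec)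
  then have L'c: "L_prime n L \<in> carrier_mat (n * n) ?m" by (intro carrier_matI) auto
  \<comment> \<open>Exactly one index contributes: the place of the reflected position
    \<open>(max i j, min i j)\<close> in \<open>tri_indices n\<close>.\<close>
  have expand: "(\<Sum>k<?m. tri_unit n k $$ (i, j) * vech M $ k) = M $$ (i, j)" if ij: "i < n" "j < n" for i j
  proof -
    have "(\<Sum>k<?m. tri_unit n k $$ (i, j) * vech M $ k) =
      (\<Sum>k<?m. if (max i j, min i j) = tri_indices n ! k then M $$ (tri_indices n ! k) else 0)"
      using ij vech_index[OF M] by (intro sum.cong) (auto simp: tri_unit_def)
    also have "\<dots> = (\<Sum>s\<in>set (tri_indices n). if (max i j, min i j) = s then M $$ s else 0)"
      by (rule sum.reindex_bij_betw[OF bij_betw_nth[OF distinct_tri_indices refl refl]])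
    also have "\<dots> = M $$ (max i j, min i j)"
      unfolding sum.delta'[OF finite_set] using ij by (simp add: set_tri_indices)
    also have "\<dots> = M $$ (i, j)" using sym[OF ij] by (simp add: max_def min_def)
    finally show ?thesis .
  qed
  show ?thesis
  proof (rule eq_vecI)
    fix c assume "c < dim_vec (vec_op (L M))"
    then have c: "c < n * n" using vec_op_eq[OF Lc[OF M]] by simp
    then have "n > 0" by (cases n) auto
    then have cn: "c mod n < n" "c div n < n" using c by (auto simp: less_mult_imp_div_less)
    have "(L_prime n L *\<^sub>v vech M) $ c = (\<Sum>k<?m. L_prime n L $$ (c, k) * vech M $ k)"
      using c dim_vech[OF M] by (intro mult_mat_vec_index[OF L'c]) (auto intro: carrier_vecI)
    also have "\<dots> = (\<Sum>k<?m. L (tri_unit n k) $$ (c mod n, c div n) * vech M $ k)"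
      unfolding L' using c vec_op_eq[OF Lc[OF tc]]
      by (intro sum.cong refl) (simp add: mat_of_cols_index)
    also have "\<dots> = (\<Sum>k<?m. \<Sum>i<n. \<Sum>j<n. tri_unit n k $$ (i, j) * vech M $ k * G i j (c mod n) (c div n))"
      unfolding G[OF tc cn] by (simp add: sum_distrib_right sum_distrib_left mult_ac)
    also have "\<dots> = (\<Sum>i<n. \<Sum>j<n. \<Sum>k<?m. tri_unit n k $$ (i, j) * vech M $ k * G i j (c mod n) (c div n))"
      by (subst sum.swap, subst (2) sum.swap) simp
    also have "\<dots> = L M $$ (c mod n, c div n)"
      unfolding G[OF M cn] sum_distrib_right[symmetric] using expand by simp
    finally show "(L_prime n L *\<^sub>v vech M) $ c = vec_op (L M) $ c"
      using vec_op_eq[OF Lc[OF M]] c by simp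
  qed (use L'c vec_op_eq[OF Lc[OF M]] in auto)
qed

section \<open>Comparison of \<open>cnorm\<close> with entrywise bounds\<close>

lemma cnorm_vech_le:
  fixes w :: real
  assumes W: "W \<in> carrier_mat n n" and le: "\<And>i j. i < n \<Longrightarrow> j < n \<Longrightarrow> cmod (W $$ (i, j)) \<le> w"
  shows "cnorm (vech W) \<le> length (tri_indices n) * w"
proof -
  have "cnorm (vech W) \<le> (\<Sum>k<length (tri_indices n). cmod (vech W $ k))"
    unfolding cnorm_def dim_vech[OF W] by (rule L2_set_le_sum) simp
  also have "\<dots> \<le> (\<Sum>k<length (tri_indices n). w)"
  proof (rule sum_mono)
    fix k assume "k \<in> {..<length (tri_indices n)}"
    then have k: "k < length (tri_indices n)" by simp
    obtain i j where "tri_indices n ! k = (i, j)" "j \<le> i" "i < n" by (rule tri_indices_nth[OF k])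
    then show "cmod (vech W $ k) \<le> w" using le[of i j] vech_index[OF W k] by simp
  qed
  finally show ?thesis by simp
qed

text \<open>Entries above the diagonal are absent from \<open>vech W\<close> but have the same
  modulus as their mirror images, so the half-vectorization controls the whole matrix.\<close>

lemma hermitian_index_le_cnorm_vech:
  assumes W: "W \<in> hermitian_mats n" and ij: "i < n" "j < n"
  shows "cmod (W $$ (i, j)) \<le> cnorm (vech W)"
proof -
  have c: "W \<in> carrier_mat n n" using W by (simp add: hermitian_mats_def)
  have low: "cmod (W $$ (i, j)) \<le> cnorm (vech W)" if "j \<le> i" "i < n" for i j
  proof -
    have "(i, j) \<in> set (tri_indices n)" using that by (simp add: set_tri_indices)
    then obtain k where k: "k < length (tri_indices n)" "tri_indices n ! k = (i, j)"
      by (auto simp: in_set_conv_nth)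
    have "cmod (vech W $ k) \<le> cnorm (vech W)"
      unfolding cnorm_def using k dim_vech[OF c]
      by (intro member_le_L2_set[of _ k "\<lambda>k. cmod (vech W $ k)"]) auto
    then show ?thesis using vech_index[OF c k(1)] k(2) by simp
  qed
  have "cmod (W $$ (i, j)) = cmod (W $$ (j, i))"
    using hermitian_index[OF W ij] by simp
  then show ?thesis using low[of j i] low[of i j] ij by (cases "j \<le> i") auto
qed

subsection \<open>The local expansion of the SCF map\<close>

lemma triple_product_index_le:
  fixes A M B :: "complex mat" and e :: real
  assumes c: "A \<in> carrier_mat n n" "M \<in> carrier_mat n n" "B \<in> carrier_mat n n"
    and A: "\<And>i j. i < n \<Longrightarrow> j < n \<Longrightarrow> cmod (A $$ (i, j)) \<le> 1"
    and B: "\<And>i j. i < n \<Longrightarrow> j < n \<Longrightarrow> cmod (B $$ (i, j)) \<le> 1"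
    and M: "\<And>i j. i < n \<Longrightarrow> j < n \<Longrightarrow> cmod (M $$ (i, j)) \<le> e"
    and ij: "i < n" "j < n"
  shows "cmod ((A * M * B) $$ (i, j)) \<le> (real n)\<^sup>2 * e"
proof -
  have AM: "A * M \<in> carrier_mat n n" using c by simp
  have 1: "cmod ((A * M) $$ (i, k)) \<le> n * (1 * e)" if "k < n" for k
    unfolding mult_mat_index[OF c(1,2) ij(1) that]
    by (rule cmod_bilinear_le) (use A M ij that in auto)
  have "cmod ((A * M * B) $$ (i, j)) \<le> n * (n * (1 * e) * 1)"
    unfolding mult_mat_index[OF AM c(3) ij]
    by (rule cmod_bilinear_le) (use 1 B ij in auto)
  then show ?thesis by (simp add: power2_eq_square mult.assoc)
qed

lemma unitary_index_le:
  assumes X: "X \<in> carrier_mat n n" "mat_adjoint X * X = 1\<^sub>m n" and ij: "i < n" "j < n"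
  shows "cmod (X $$ (i, j)) \<le> 1"
proof -
  have X': "mat_adjoint X \<in> carrier_mat n n" using X by simp
  have "(\<Sum>k<n. mat_adjoint X $$ (j, k) * X $$ (k, j)) = 1"
    using mult_mat_index[OF X' X(1) ij(2,2)] X(2) ij by simp
  also have "(\<Sum>k<n. mat_adjoint X $$ (j, k) * X $$ (k, j)) = (\<Sum>k<n. of_real ((cmod (X $$ (k, j)))\<^sup>2))"
    using X(1) ij by (intro sum.cong refl) (simp add: complex_norm_square mult.commute del: of_real_power)
  also have "\<dots> = of_real (\<Sum>k<n. (cmod (X $$ (k, j)))\<^sup>2)" by simp
  finally have "(\<Sum>k<n. (cmod (X $$ (k, j)))\<^sup>2) = 1" using of_real_eq_1_iff by blast
  moreover have "(cmod (X $$ (i, j)))\<^sup>2 \<le> (\<Sum>k<n. (cmod (X $$ (k, j)))\<^sup>2)"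
    using ij by (intro member_le_sum) auto
  ultimately show ?thesis by (simp add: power_le_one_iff abs_square_le_1)
qed

text \<open>Continuity of a linear map in finite dimension, for the largest entry as norm. The
  constant is the sum of the moduli of all coefficients, a crude choice that is independent of the
  output position.\<close>

lemma complex_linear_on_mats_bounded:
  assumes "complex_linear_on_mats n L"
  obtains c :: real where "0 \<le> c" "\<And>U u a b. U \<in> carrier_mat n n \<Longrightarrow>
    (\<And>i j. i < n \<Longrightarrow> j < n \<Longrightarrow> cmod (U $$ (i, j)) \<le> u) \<Longrightarrow> a < n \<Longrightarrow> b < n \<Longrightarrow>
    cmod (L U $$ (a, b)) \<le> c * u"
proof -
  obtain G where G: "\<And>U a b. U \<in> carrier_mat n n \<Longrightarrow> a < n \<Longrightarrow> b < n \<Longrightarrow>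
    L U $$ (a, b) = (\<Sum>i<n. \<Sum>j<n. U $$ (i, j) * G i j a b)"
    using complex_linear_on_mats_coeffs[OF assms] by blast
  define s where "s a b = (\<Sum>i<n. \<Sum>j<n. cmod (G i j a b))" for a b
  have s0: "0 \<le> s a b" for a b unfolding s_def by (intro sum_nonneg) auto
  define c where "c = (\<Sum>a<n. \<Sum>b<n. s a b)"
  have sc: "s a b \<le> c" if "a < n" "b < n" for a b
  proof -
    have "s a b \<le> (\<Sum>b<n. s a b)" using that s0 by (intro member_le_sum) auto
    also have "\<dots> \<le> c" unfolding c_def
      using that s0 by (intro member_le_sum[of a _ "\<lambda>a. \<Sum>b<n. s a b"]) (auto intro: sum_nonneg)
    finally show ?thesis .
  qed
  show ?thesis
  proof (rule that[of c])
    show "0 \<le> c" unfolding c_def using s0 by (intro sum_nonneg) auto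
    fix U :: "complex mat" and u a b
    assume U: "U \<in> carrier_mat n n" "\<And>i j. i < n \<Longrightarrow> j < n \<Longrightarrow> cmod (U $$ (i, j)) \<le> u"
      and ab: "a < n" "b < n"
    have u0: "0 \<le> u" using U(2)[OF ab] norm_ge_zero order_trans by blast
    have "cmod (L U $$ (a, b)) \<le> (\<Sum>i<n. \<Sum>j<n. u * cmod (G i j a b))"
      unfolding G[OF U(1) ab]
      by (intro sum_norm_le) (auto simp: norm_mult intro!: mult_right_mono U(2))
    also have "\<dots> = u * s a b" by (simp add: s_def sum_distrib_left)
    also have "\<dots> \<le> c * u" using mult_right_mono[OF sc[OF ab] u0] by (simp add: mult.commute)
    finally show "cmod (L U $$ (a, b)) \<le> c * u" .
  qed
qed

lemma conj_cancel:
  assumes X: "X \<in> carrier_mat n n" "X * mat_adjoint X = 1\<^sub>m n" and Q: "Q \<in> carrier_mat n n"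
  shows "X * (mat_adjoint X * Q * X) * mat_adjoint X = Q"
proof -
  have X': "mat_adjoint X \<in> carrier_mat n n" using X by simp
  have "X * (mat_adjoint X * Q * X) = Q * X"
    using assoc_mult_mat[OF X(1) X', of "Q * X" n] assoc_mult_mat[OF X' Q X(1)]
      left_mult_one_mat[of "Q * X" n n] X Q by simp
  then show ?thesis
    using assoc_mult_mat[OF Q X(1) X'] X(2) right_mult_one_mat[OF Q] by simp
qed

lemma orth_projector_mat_diag:
  assumes "p \<le> n"
  shows "orth_projector n p (mat_diag n (\<lambda>i. if i < p then 1 else 0))"
proof -
  have "(\<Sum>i<n. if i < p then 1 else 0 :: complex) = of_nat p"
    using sum_split_at[OF assms, of "\<lambda>i. if i < p then 1 else 0 :: complex"] by simp
  moreover have "(\<Sum>i<n. mat_diag n (\<lambda>i. if i < p then 1 else 0 :: complex) $$ (i, i))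
      = (\<Sum>i<n. if i < p then 1 else 0)"
    by (intro sum.cong) (auto simp: mat_diag_def)
  moreover have "mat_diag n (\<lambda>i. (if i < p then 1 else 0) * (if i < p then 1 else 0 :: complex))
     = mat_diag n (\<lambda>i. if i < p then 1 else 0)"
    by (intro arg_cong[of _ _ "mat_diag n"]) auto
  moreover have "mat_diag n (\<lambda>i. if i < p then 1 else 0) \<in> hermitian_mats n"
    by (rule hermitianI) (auto simp: mat_diag_def)
  ultimately show ?thesis by (simp add: orth_projector_def mat_trace_def)
qed

text \<open>Transports \<open>projector_perturbation\<close> out of the eigenbasis. Here
  \<open>E\<close> is the perturbation in the original basis and \<open>Emat\<close> the model
  projector. In the constant, the inner factor \<open>(real n)\<^sup>2\<close> bounds the entries of
  \<open>mat_adjoint X * E * X\<close>, the outer one comes from returning through \<open>X\<close>,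
  and the length of \<open>tri_indices n\<close> from passing from entries to
  \<open>cnorm\<close>.\<close>

lemma lowest_projector_response:
  fixes n p :: nat and lam :: "nat \<Rightarrow> real" and H E X V :: "complex mat" and e :: real
  defines "Emat \<equiv> mat_diag n (\<lambda>i. if i < p then 1 else 0 :: complex)"
    and "g \<equiv> lam p - lam (p - 1)"
  assumes p: "1 \<le> p" "p < n" and mono: "\<And>i j. i \<le> j \<Longrightarrow> j < n \<Longrightarrow> lam i \<le> lam j"
    and gap: "0 < g"
    and X: "X \<in> carrier_mat n n" "mat_adjoint X * X = 1\<^sub>m n" "X * mat_adjoint X = 1\<^sub>m n"
    and H: "H \<in> carrier_mat n n"
    and eig: "H * X = X * mat_diag n (\<lambda>i. complex_of_real (lam i))"
    and E: "E \<in> carrier_mat n n" "\<And>i j. i < n \<Longrightarrow> j < n \<Longrightarrow> cmod (E $$ (i, j)) \<le> e"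
    and HE: "H + E \<in> hermitian_mats n"
    and V: "lowest_eigbasis n p (H + E) V"
  shows "cnorm (vech (V * mat_adjoint V - X * Emat * mat_adjoint X) - response_mat n p X lam *\<^sub>v vec_op E)
    \<le> length (tri_indices n) * ((real n)\<^sup>2 * ((4 * real n ^ 3 / g\<^sup>2 + 4 * real n ^ 5 / g\<^sup>2) * ((real n)\<^sup>2 * e)\<^sup>2))"
proof -
  have X': "mat_adjoint X \<in> carrier_mat n n" using X by simp
  define Q where "Q = V * mat_adjoint V"
  define P where "P = X * Emat * mat_adjoint X"
  define Lam where "Lam = mat_diag n (\<lambda>i. complex_of_real (lam i))"
  define F where "F = mat_adjoint X * E * X"
  define Qt where "Qt = mat_adjoint X * Q * X"
  have Q: "orth_projector n p Q" "(H + E) * Q = Q * (H + E)"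
    "mat_trace n ((H + E) * Q) = (\<Sum>i<p. complex_of_real (sorted_eigvals (H + E) ! i))"
    using lowest_eigbasis_projector[OF _ HE V] p by (auto simp: Q_def)
  have Em: "orth_projector n p Emat" unfolding Emat_def using p by (intro orth_projector_mat_diag) simp
  have P: "orth_projector n p P"
    using orth_projector_conj[OF X' _ Em] X(2) by (simp add: P_def)
  have Qt: "orth_projector n p Qt" unfolding Qt_def by (rule orth_projector_conj[OF X(1,3) Q(1)])
  have c: "Q \<in> carrier_mat n n" "Emat \<in> carrier_mat n n" "P \<in> carrier_mat n n" "Qt \<in> carrier_mat n n"
    using Q Em P Qt by (auto simp: orth_projector_def hermitian_carrier)
  have c': "F \<in> carrier_mat n n" "Lam \<in> carrier_mat n n" "H + E \<in> carrier_mat n n"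
    using X X' E H by (auto simp: F_def Lam_def intro!: mult_carrier_mat[of _ n n])
  have PX: "mat_adjoint X * P * X = Emat"
    using conj_cancel[of "mat_adjoint X" n Emat] X X' c by (simp add: P_def)
  have "mat_adjoint X * H * X = Lam"
    using assoc_mult_mat[OF X' H X(1)] assoc_mult_mat[OF X' X(1) c'(2)] left_mult_one_mat[OF c'(2)]
    unfolding eig Lam_def[symmetric] X(2) by simp
  then have LF: "mat_adjoint X * (H + E) * X = Lam + F"
    using X X' H E(1) unfolding F_def
    by (simp add: mult_add_distrib_mat[of _ n n _ n] add_mult_distrib_mat[of _ n n _ _ n])
  have eX: "cmod (X $$ (i, j)) \<le> 1" "cmod (mat_adjoint X $$ (i, j)) \<le> 1" if "i < n" "j < n" for i j
    using unitary_index_le[OF X(1,2)] X(1) that by auto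
  have f: "cmod (F $$ (i, j)) \<le> (real n)\<^sup>2 * e" if "i < n" "j < n" for i j
    unfolding F_def by (rule triple_product_index_le[where n = n]) (use X X' E eX that in auto)
  have comm: "(Lam + F) * Qt = Qt * (Lam + F)"
    unfolding LF[symmetric] Qt_def
    using conj_mult[OF X(1,3) c'(3) c(1)] conj_mult[OF X(1,3) c(1) c'(3)] Q(2) by simp
  have tr: "mat_trace n ((Lam + F) * (mat_adjoint X * Y * X)) = mat_trace n ((H + E) * Y)"
    if "Y \<in> carrier_mat n n" for Y
    unfolding LF[symmetric] conj_mult[OF X(1,3) c'(3) that]
    using c'(3) that by (intro mat_trace_conj[OF X(1,3)]) simp
  obtain U where U: "U \<in> carrier_mat n n" "mat_adjoint U * U = 1\<^sub>m n"
    "mat_adjoint U * (H + E) * U = mat_diag n (\<lambda>i. complex_of_real (sorted_eigvals (H + E) ! i))"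
    using hermitian_sorted_eigbasis(1)[OF HE] by blast
  have "Re (mat_trace n ((H + E) * Q)) = (\<Sum>i<p. sorted_eigvals (H + E) ! i)"
    unfolding Q(3) by simp
  \<comment> \<open>The unperturbed projector \<open>P\<close> is a competitor in the minimum
    principle for \<open>H + E\<close>. The principle is applied in an eigenbasis \<open>U\<close>
    of \<open>H + E\<close>, unrelated to \<open>X\<close>.\<close>
  also have "\<dots> \<le> Re (mat_trace n ((H + E) * P))"
    by (rule ky_fan[OF p _ U(1,2) c'(3) U(3) P])
      (use hermitian_sorted_eigbasis(2,3)[OF HE] in \<open>auto intro: sorted_nth_mono\<close>)
  finally have min: "Re (mat_trace n ((Lam + F) * Qt)) \<le> Re (mat_trace n ((Lam + F) * Emat))"
    using tr[OF c(1)] tr[OF c(3)] PX by (simp add: Qt_def)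
  define S where "S = mat n n (\<lambda>ij. R_mat n p lam $$ ij * F $$ ij)"
  \<comment> \<open>\<open>B\<close> is the second-order remainder in the eigenbasis. Conjugated
    back by \<open>X\<close> it is exactly the matrix whose half-vectorization has to be
    estimated.\<close>
  define B where "B = Qt - Emat + S"
  define K where "K = (4 * real n ^ 3 / g\<^sup>2 + 4 * real n ^ 5 / g\<^sup>2) * ((real n)\<^sup>2 * e)\<^sup>2"
  have Sc: "S \<in> carrier_mat n n" and Bc: "B \<in> carrier_mat n n" using c by (auto simp: S_def B_def)
  have B: "cmod (B $$ (i, j)) \<le> K" if "i < n" "j < n" for i j
  proof -
    have "cmod (Qt $$ (i, j) - Emat $$ (i, j) + R_mat n p lam $$ (i, j) * F $$ (i, j)) \<le> K"
      unfolding K_def g_def Emat_def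
      by (rule projector_perturbation[OF p mono _ c'(1) f Qt])
        (use gap comm min that in \<open>auto simp: g_def Lam_def Emat_def\<close>)
    then show ?thesis using that c Sc by (simp add: B_def S_def)
  qed
  have "X * B * mat_adjoint X = X * Qt * mat_adjoint X - P + X * S * mat_adjoint X"
  proof -
    have m: "Qt - Emat \<in> carrier_mat n n" by (rule minus_carrier_mat[OF c(2)])
    have m': "X * Qt - X * Emat \<in> carrier_mat n n" using X(1) c(2) by (intro minus_carrier_mat) simp
    have "X * B = X * Qt - X * Emat + X * S"
      unfolding B_def using X(1) c Sc m
      by (simp add: mult_add_distrib_mat[of _ n n _ n] mult_minus_distrib_mat[of _ n n _ n])
    then show ?thesis unfolding P_def using X(1) X' c Sc m'
      by (simp add: add_mult_distrib_mat[of _ n n _ _ n] minus_mult_distrib_mat[of _ n n _ _ n])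
  qed
  also have "X * Qt * mat_adjoint X = Q" unfolding Qt_def by (rule conj_cancel[OF X(1,3) c(1)])
  finally have XBX: "X * B * mat_adjoint X = Q - P + X * S * mat_adjoint X" .
  have XSX: "X * S * mat_adjoint X \<in> carrier_mat n n" using X X' Sc by simp
  have "vech (Q - P) - response_mat n p X lam *\<^sub>v vec_op E = vech (Q - P) - vech (- (X * S * mat_adjoint X))"
    unfolding response_mat_mult_vec_op[OF X(1) E(1)] vech_uminus[OF XSX] by (simp add: S_def F_def)
  also have "\<dots> = vech (Q - P - (- (X * S * mat_adjoint X)))"
    using c XSX by (intro vech_minus[symmetric]) auto
  also have "Q - P - (- (X * S * mat_adjoint X)) = X * B * mat_adjoint X"
    unfolding XBX by (rule eq_matI) (use c XSX in \<open>auto simp del: index_mult_mat(1)\<close>)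
  also have "cnorm (vech (X * B * mat_adjoint X)) \<le> length (tri_indices n) * ((real n)\<^sup>2 * K)"
    by (rule cnorm_vech_le, use X X' Bc in simp, rule triple_product_index_le)
      (use X X' Bc eX B in auto)
  finally show ?thesis by (simp add: Q_def P_def K_def)
qed

theorem theorem1:
  fixes n p :: nat
    and A L :: "complex mat \<Rightarrow> complex mat"
    and A0 Pstar X1 X2 X :: "complex mat"
    and lam :: "nat \<Rightarrow> real"
  assumes p: "1 \<le> p" "p < n"
    and A0: "A0 \<in> hermitian_mats n"
    and L: "complex_linear_on_mats n L"
    and A: "\<And>P. P \<in> hermitian_mats n \<Longrightarrow> A P = A0 + L P"
           "\<And>P. P \<in> hermitian_mats n \<Longrightarrow> A P \<in> hermitian_mats n"
    and X: "X1 \<in> carrier_mat n p" "X2 \<in> carrier_mat n (n - p)"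
           "X = mat_of_cols n (cols X1 @ cols X2)"
           "mat_adjoint X * X = 1\<^sub>m n" "X * mat_adjoint X = 1\<^sub>m n"
    and Pstar: "Pstar = X1 * mat_adjoint X1"
    and fixed_point: "Pstar = scf_map n p A Pstar"
    and eig: "A Pstar * X = X * mat_diag n (\<lambda>i. complex_of_real (lam i))"
    and lam_sorted: "\<And>i j. i \<le> j \<Longrightarrow> j < n \<Longrightarrow> lam i \<le> lam j"
    and gap: "lam p - lam (p - 1) \<noteq> 0"
  shows "\<exists>C \<delta>. \<delta> > 0 \<and>
    (\<forall>P :: nat \<Rightarrow> complex mat. \<forall>k.
       P k \<in> scf_domain n p A \<longrightarrow> P (Suc k) = scf_map n p A (P k) \<longrightarrow>
       cnorm (vech (P k - Pstar)) < \<delta> \<longrightarrow>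
         (elements_mat (P k - Pstar) \<subseteq> \<real> \<longrightarrow>
            cnorm (vech (P (Suc k) - Pstar) - J_mat n p X lam L *\<^sub>v vech (P k - Pstar))
              \<le> C * (cnorm (vech (P k - Pstar)))\<^sup>2) \<and>
         cnorm (vech (P (Suc k) - Pstar) - response_mat n p X lam *\<^sub>v vec_op (L (P k - Pstar)))
           \<le> C * (cnorm (vech (P k - Pstar)))\<^sup>2)"
proof -
  define Emat where "Emat = mat_diag n (\<lambda>i. if i < p then 1 else 0 :: complex)"
  have Xc: "X \<in> carrier_mat n n" using X(1-3) p by (intro carrier_matI) auto
  have X': "mat_adjoint X \<in> carrier_mat n n" and X1': "mat_adjoint X1 \<in> carrier_mat p n" using Xc X(1) by auto
  have Ec: "Emat \<in> carrier_mat n n" by (simp add: Emat_def)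
  have X1: "X $$ (i, k) = X1 $$ (i, k)" if "i < n" "k < p" for i k
    using that X(1-3) p by (simp add: mat_of_cols_index nth_append)
  \<comment> \<open>Multiplication by the diagonal 0-1 matrix keeps the first \<open>p\<close>
    columns of \<open>X\<close>, which are those of \<open>X1\<close>, and annihilates the
    others.\<close>
  have PE: "Pstar = X * Emat * mat_adjoint X"
  proof (rule eq_matI)
    fix i j assume "i < dim_row (X * Emat * mat_adjoint X)" "j < dim_col (X * Emat * mat_adjoint X)"
    then have ij: "i < n" "j < n" using Xc by auto
    have XE: "X * Emat = mat n n (\<lambda>(i, k). X $$ (i, k) * (if k < p then 1 else 0))"
      unfolding Emat_def by (rule mat_diag_mult_right[OF Xc])
    have "(X * Emat * mat_adjoint X) $$ (i, j) = (\<Sum>k<n. (X * Emat) $$ (i, k) * mat_adjoint X $$ (k, j))"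
      using Xc X' Ec ij by (intro mult_mat_index) auto
    also have "\<dots> = (\<Sum>k<n. if k < p then X1 $$ (i, k) * cnj (X1 $$ (j, k)) else 0)"
      unfolding XE using Xc ij X1 by (intro sum.cong) auto
    also have "\<dots> = (\<Sum>k<p. X1 $$ (i, k) * mat_adjoint X1 $$ (k, j))"
      using sum_split_at[of p n "\<lambda>k. if k < p then X1 $$ (i, k) * cnj (X1 $$ (j, k)) else 0"] p X(1) ij
      by simp
    also have "\<dots> = Pstar $$ (i, j)"
      unfolding Pstar by (rule mult_mat_index[OF X(1) X1' ij, symmetric])
    finally show "Pstar $$ (i, j) = (X * Emat * mat_adjoint X) $$ (i, j)" by simp
  qed (use X(1) Xc Pstar in auto)
  have Ph: "Pstar \<in> hermitian_mats n"
    using mat_adjoint_mult[OF X(1) X1'] X(1) by (simp add: Pstar hermitian_mats_def)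
  have Pc: "Pstar \<in> carrier_mat n n" by (rule hermitian_carrier[OF Ph])
  have Lc: "L U \<in> carrier_mat n n" if "U \<in> carrier_mat n n" for U
    using L that by (auto simp: complex_linear_on_mats_def)
  have Hc: "A Pstar \<in> carrier_mat n n" by (rule hermitian_carrier[OF A(2)[OF Ph]])
  have g: "0 < lam p - lam (p - 1)" using gap lam_sorted[of "p - 1" p] p by simp
  obtain c where c: "0 \<le> c" "\<And>U u a b. U \<in> carrier_mat n n \<Longrightarrow>
    (\<And>i j. i < n \<Longrightarrow> j < n \<Longrightarrow> cmod (U $$ (i, j)) \<le> u) \<Longrightarrow> a < n \<Longrightarrow> b < n \<Longrightarrow>
    cmod (L U $$ (a, b)) \<le> c * u"
    using complex_linear_on_mats_bounded[OF L] by metis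
  let ?K = "4 * real n ^ 3 / (lam p - lam (p - 1))\<^sup>2 + 4 * real n ^ 5 / (lam p - lam (p - 1))\<^sup>2"
  \<comment> \<open>This is the constant of \<open>lowest_projector_response\<close> for a
    perturbation with entries at most \<open>c\<close> times the norm of the half-vectorized
    difference; the square of that norm is factored out.\<close>
  let ?C = "length (tri_indices n) * ((real n)\<^sup>2 * (?K * ((real n)\<^sup>2 * c)\<^sup>2))"
  have step: "cnorm (vech (P' - Pstar) - response_mat n p X lam *\<^sub>v vec_op (L (P - Pstar)))
      \<le> ?C * (cnorm (vech (P - Pstar)))\<^sup>2"
    if P: "P \<in> scf_domain n p A" and P': "P' = scf_map n p A P" for P P'
  proof -
    have PH: "P \<in> hermitian_mats n" using P by (simp add: scf_domain_def)
    have PC: "P \<in> carrier_mat n n" by (rule hermitian_carrier[OF PH])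
    have dH: "P - Pstar \<in> hermitian_mats n"
    proof (rule hermitianI)
      fix i j assume "i < n" "j < n"
      then show "(P - Pstar) $$ (i, j) = cnj ((P - Pstar) $$ (j, i))"
        using hermitian_index[OF PH, of i j] hermitian_index[OF Ph, of i j] PC Pc by simp
    qed (rule minus_carrier_mat[OF Pc])
    have dc: "P - Pstar \<in> carrier_mat n n" by (rule hermitian_carrier[OF dH])
    let ?E = "L (P - Pstar)"
    \<comment> \<open>Writing \<open>P\<close> as a sum lets the additivity of \<open>L\<close> show
      that \<open>A\<close> changes by exactly \<open>L (P - Pstar)\<close>; the remainder in the
      expansion stems from the spectral projector alone.\<close>
    have "P = Pstar + (P - Pstar)" by (rule eq_matI) (use PC Pc in auto)
    then have "L P = L Pstar + ?E"
      using L Pc dc by (metis complex_linear_on_mats_def)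
    then have AP: "A P = A Pstar + ?E"
      using A(1)[OF PH] A(1)[OF Ph] A0 Lc[OF Pc] Lc[OF dc]
      by (simp add: assoc_add_mat[of _ n n] hermitian_carrier)
    define V where "V = (SOME V. lowest_eigbasis n p (A P) V)"
    have V: "lowest_eigbasis n p (A P) V"
      unfolding V_def by (rule someI_ex[OF lowest_eigbasis_exists[OF less_imp_le[OF p(2)] A(2)[OF PH]]])
    have e: "cmod (?E $$ (i, j)) \<le> c * cnorm (vech (P - Pstar))" if "i < n" "j < n" for i j
      using hermitian_index_le_cnorm_vech[OF dH] that by (intro c(2)[OF dc]) auto
    have "P' = V * mat_adjoint V" by (simp add: P' scf_map_def V_def Let_def)
    moreover have "cnorm (vech (V * mat_adjoint V - X * Emat * mat_adjoint X) - response_mat n p X lam *\<^sub>v vec_op ?E)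
      \<le> length (tri_indices n) * ((real n)\<^sup>2 * (?K * ((real n)\<^sup>2 * (c * cnorm (vech (P - Pstar))))\<^sup>2))"
      unfolding Emat_def
      by (rule lowest_projector_response[OF p lam_sorted g Xc X(4,5) Hc eig Lc[OF dc] e
            A(2)[OF PH, unfolded AP] V[unfolded AP]])
    ultimately have "cnorm (vech (P' - Pstar) - response_mat n p X lam *\<^sub>v vec_op ?E)
      \<le> length (tri_indices n) * ((real n)\<^sup>2 * (?K * ((real n)\<^sup>2 * (c * cnorm (vech (P - Pstar))))\<^sup>2))"
      by (simp only: PE[symmetric])
    also have "\<dots> = ?C * (cnorm (vech (P - Pstar)))\<^sup>2" by (simp add: power_mult_distrib)
    finally show ?thesis .
  qed
  have J: "J_mat n p X lam L *\<^sub>v vech (P - Pstar) = response_mat n p X lam *\<^sub>v vec_op (L (P - Pstar))"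
    if P: "P \<in> scf_domain n p A" and real: "elements_mat (P - Pstar) \<subseteq> \<real>" for P
  proof -
    have PH: "P \<in> hermitian_mats n" using P by (simp add: scf_domain_def)
    have PC: "P \<in> carrier_mat n n" by (rule hermitian_carrier[OF PH])
    have dc: "P - Pstar \<in> carrier_mat n n" by (rule minus_carrier_mat[OF Pc])
    \<comment> \<open>For a Hermitian matrix real entries amount to symmetry, the condition under
      which \<open>L_prime\<close> reproduces \<open>L\<close> on half-vectorized matrices.\<close>
    have sym: "(P - Pstar) $$ (i, j) = (P - Pstar) $$ (j, i)" if ij: "i < n" "j < n" for i j
    proof -
      have "(P - Pstar) $$ (j, i) \<in> elements_mat (P - Pstar)"
        by (rule elements_matI[OF dc ij(2,1) refl])
      then have "(P - Pstar) $$ (j, i) \<in> \<real>" using real by blast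
      then have "cnj ((P - Pstar) $$ (j, i)) = (P - Pstar) $$ (j, i)" by (simp add: Reals_cnj_iff)
      then show ?thesis
        using hermitian_index[OF PH ij] hermitian_index[OF Ph ij] PC Pc ij by simp
    qed
    have Rc: "response_mat n p X lam \<in> carrier_mat (length (tri_indices n)) (n * n)"
      using T_mat_carrier[of n] kron_carrier[of "transpose_mat X" n n "mat_adjoint X" n n] Xc
      by (intro carrier_matI) (auto simp: response_mat_def kron_def)
    have L'c: "L_prime n L \<in> carrier_mat (n * n) (length (tri_indices n))"
      by (intro carrier_matI) (simp_all add: L_prime_def length_tri_indices)
    have "L_prime n L *\<^sub>v vech (P - Pstar) = vec_op (L (P - Pstar))"
      by (rule L_prime_mult_vech[OF L dc]) (rule sym)
    moreover have "vech (P - Pstar) \<in> carrier_vec (length (tri_indices n))"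
      by (rule carrier_vecI) (rule dim_vech[OF dc])
    note assoc_mult_mat_vec[OF Rc L'c this]
    ultimately show ?thesis unfolding J_mat_def by (simp only:)
  qed
  show ?thesis
  \<comment> \<open>The bound \<open>step\<close> is uniform over \<open>scf_domain\<close>, so the
    radius 1 is an arbitrary positive witness.\<close>
  proof (rule exI[of _ ?C], rule exI[of _ "1 :: real"], intro conjI allI impI)
    fix P :: "nat \<Rightarrow> complex mat" and k
    assume P: "P k \<in> scf_domain n p A" "P (Suc k) = scf_map n p A (P k)"
    show "cnorm (vech (P (Suc k) - Pstar) - response_mat n p X lam *\<^sub>v vec_op (L (P k - Pstar)))
      \<le> ?C * (cnorm (vech (P k - Pstar)))\<^sup>2"
      by (rule step[OF P])
    assume real: "elements_mat (P k - Pstar) \<subseteq> \<real>"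
    show "cnorm (vech (P (Suc k) - Pstar) - J_mat n p X lam L *\<^sub>v vech (P k - Pstar))
      \<le> ?C * (cnorm (vech (P k - Pstar)))\<^sup>2"
      unfolding J[OF P(1) real] by (rule step[OF P])
  qed simp
qed

end
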